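(* Let $\mathcal{A}$ be the coefficient-free quantum cluster algebra of type $A_1^{(1)}$, that is, with initial quantum seed given by $m=n=2$, $d_1=d_2=2$, $\tilde B=B=\begin{pmatrix}0&-2\\2&0\end{pmatrix}$, $\Lambda=\begin{pmatrix}0&-1\\1&0\end{pmatrix}$ and $\tilde{\mathbf{X}}=(X_1,X_2)$. The canonical triangular basis of $\mathcal{A}$ consists of all cluster monomials $$v^{a_1a_2}X_m^{a_1}X_{m+1}^{a_2}\qquad(a_1,a_2\in\mathbb{Z}_{\ge0},\ m\in\mathbb{Z})$$ and the elements $S_r(X_\delta)$ for all $r\ge1$.
   Context: The algebra $\mathcal{A}$: let $\mathcal{T}$ be the $\mathbb{Z}[v,v^{-1}]$-algebra generated by $X_1^{\pm1},X_2^{\pm1}$ with $X_2X_1=v^2X_1X_2$, and $\mathcal{F}$ its skew-field of fractions. The cluster variables $X_m\in\mathcal{F}$ ($m\in\mathbb{Z}$) are determined by the exchange relations $$X_{m+1}X_{m-1}=v^2X_m^2+1\qquad(m\in\mathbb{Z});$$ they also satisfy $X_{m+1}X_m=v^2X_mX_{m+1}$. $\mathcal{A}$ is the $\mathbb{Z}[v,v^{-1}]$-subalgebra of $\mathcal{F}$ generated by all $X_m$, $m\in\mathbb{Z}$ (there are no frozen variables); it is contained in $\mathcal{T}$. The clusters are $\{X_m,X_{m+1}\}$, $m\in\mathbb{Z}$, and all seeds are acyclic. Bar-involution: the $\mathbb{Z}$-linear involution of $\mathcal{A}$ with $\overline v=v^{-1}$, $\overline{XY}=\overline Y\,\overline X$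 and $\overline{X_m}=X_m$ for all $m\in\mathbb{Z}$. Canonical triangular basis. For $a=(a_1,a_2)\in\mathbb{Z}^2$ put $$E_a=v^{a_1a_2}X_3^{[-a_1]_+}X_1^{[a_1]_+}X_2^{[a_2]_+}X_0^{[-a_2]_+},\qquad [c]_+=\max(c,0).$$ These form a $\mathbb{Z}[v,v^{-1}]$-basis of $\mathcal{A}$ (they are the standard basis elements associated with the initial seed and the linear order $1\lhd2$). The canonical triangular basis is the $\mathbb{Z}[v,v^{-1}]$-basis $\{C_a:a\in\mathbb{Z}^2\}$ of $\mathcal{A}$ uniquely determined by $\overline{C_a}=C_a$ and $C_a-E_a\in\bigoplus_{a'\in\mathbb{Z}^2}v\mathbb{Z}[v]E_{a'}$. (The same basis is obtained from any other seed, with the analogous compatible linear order.) $X_\delta=vX_3X_0-v^3X_2X_1\in\mathcal{A}$. The normalized Chebyshev polynomials of the second kind $S_r(z)$ are given by $S_{-1}(z)=0$, $S_0(z)=1$, $S_r(z)=zS_{r-1}(z)-S_{r-2}(z)$ for $r\ge1$. *)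

theory Defs
  imports Complex_Main "HOL-Library.Poly_Mapping" "HOL-Library.FuncSet"
begin

text \<open>
  The ring \<open>\<int>[v, v\<inverse>]\<close> is the group ring of \<open>\<int>\<close>: finitely supported functions \<open>int \<Rightarrow> int\<close>
  with convolution product, sending an exponent to its coefficient.
\<close>

type_synonym laurent = "int \<Rightarrow>\<^sub>0 int"

definition eval_laurent :: "'a::division_ring \<Rightarrow> laurent \<Rightarrow> 'a" where
  "eval_laurent v p = (\<Sum>k\<in>Poly_Mapping.keys p. of_int (Poly_Mapping.lookup p k) * v powi k)"

definition lscale :: "'a::division_ring \<Rightarrow> laurent \<Rightarrow> 'a \<Rightarrow> 'a" where
  "lscale v p x = eval_laurent v p * x"

text \<open>The ideal \<open>v\<int>[v]\<close> of \<open>\<int>[v]\<close>.\<close>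

definition v_Zv :: "laurent set" where
  "v_Zv = {p. \<forall>k\<in>Poly_Mapping.keys p. k > 0}"

lemma eval_laurent_superset:
  assumes "finite S" "Poly_Mapping.keys p \<subseteq> S"
  shows "eval_laurent v p = (\<Sum>k\<in>S. of_int (Poly_Mapping.lookup p k) * v powi k)"
  unfolding eval_laurent_def using assms
  by (intro sum.mono_neutral_left) (auto simp: in_keys_iff)

lemma eval_laurent_diff: "eval_laurent v (p - q) = eval_laurent v p - eval_laurent v q"
proof -
  let ?S = "Poly_Mapping.keys p \<union> Poly_Mapping.keys q"
  have "Poly_Mapping.keys (p - q) \<subseteq> ?S"
    by (auto simp: in_keys_iff lookup_minus)
  then show ?thesis
    by (simp add: eval_laurent_superset[where S = ?S] lookup_minus algebra_simps sum_subtractf)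
qed

lemma eval_laurent_0 [simp]: "eval_laurent v 0 = 0"
  by (simp add: eval_laurent_def)

lemma eval_laurent_add: "eval_laurent v (p + q) = eval_laurent v p + eval_laurent v q"
  using eval_laurent_diff[of v "p + q" q] by (simp add: algebra_simps)

lemma eval_laurent_single: "eval_laurent v (Poly_Mapping.single k c) = of_int c * v powi k"
  by (simp add: eval_laurent_def)

lemma eval_laurent_mult:
  assumes "v \<noteq> 0"
  shows "eval_laurent v (p * q) = eval_laurent v p * eval_laurent v q"
proof -
  have single: "eval_laurent v (Poly_Mapping.single i 1 * q) = v powi i * eval_laurent v q" for i
    using subset_UNIV[of "Poly_Mapping.keys q"]
  proof (induction q rule: frag_induction)
    case (one j)
    then show ?case
      using assms by (simp add: mult_single eval_laurent_single power_int_add)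
  qed (simp_all add: right_diff_distrib eval_laurent_diff)
  show ?thesis
    using subset_UNIV[of "Poly_Mapping.keys p"]
  proof (induction p rule: frag_induction)
    case (one j)
    then show ?case using single[of j] by (simp add: eval_laurent_single)
  qed (simp_all add: left_diff_distrib eval_laurent_diff)
qed

lemma module_lscale:
  assumes "v \<noteq> 0"
  shows "module (lscale v)"
proof
  fix x :: 'a
  have "eval_laurent v 1 = 1"
    using eval_laurent_single[of v 0 1] by simp
  then show "lscale v 1 x = x"
    by (simp add: lscale_def)
qed (use assms in \<open>simp_all add: lscale_def eval_laurent_add eval_laurent_mult algebra_simps\<close>)

text \<open>The family \<open>b\<close> (not merely its range) is a \<open>\<int>[v, v\<inverse>]\<close>-basis of \<open>M\<close>.\<close>

definition laurent_basis :: "'a::division_ring \<Rightarrow> ('i \<Rightarrow> 'a) \<Rightarrow> 'a set \<Rightarrow> bool" where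
  "laurent_basis v b M \<longleftrightarrow>
     inj b \<and> \<not> module.dependent (lscale v) (range b) \<and> module.span (lscale v) (range b) = M"

text \<open>The unital \<open>\<int>[v, v\<inverse>]\<close>-subalgebra generated by \<open>G\<close>.\<close>

inductive_set laurent_subalgebra :: "'a::division_ring \<Rightarrow> 'a set \<Rightarrow> 'a set" for v G where
  gen: "x \<in> G \<Longrightarrow> x \<in> laurent_subalgebra v G"
| scalar: "eval_laurent v p \<in> laurent_subalgebra v G"
| add: "x \<in> laurent_subalgebra v G \<Longrightarrow> y \<in> laurent_subalgebra v G \<Longrightarrow> x + y \<in> laurent_subalgebra v G"
| mult: "x \<in> laurent_subalgebra v G \<Longrightarrow> y \<in> laurent_subalgebra v G \<Longrightarrow> x * y \<in> laurent_subalgebra v G"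

definition quantum_torus :: "'a::division_ring \<Rightarrow> 'a \<Rightarrow> 'a \<Rightarrow> 'a set" where
  "quantum_torus v x1 x2 = laurent_subalgebra v {x1, inverse x1, x2, inverse x2}"

text \<open>
  The whole type \<open>'a\<close> is the skew-field of fractions of the \<open>\<int>[v, v\<inverse>]\<close>-algebra presented by
  generators \<open>x1\<^sup>\<plusminus>\<close>, \<open>x2\<^sup>\<plusminus>\<close> and the relation \<open>x2 x1 = v\<^sup>2 x1 x2\<close>. That no relations hold
  beyond the presented ones is expressed by the monomials \<open>x1\<^sup>a x2\<^sup>b\<close> being a \<open>\<int>[v, v\<inverse>]\<close>-basis
  of the subalgebra they generate; in particular \<open>v\<close> is
  transcendental over the prime field, which is \<open>\<rat>\<close>. The algebra is an
  Ore domain, so one-sided fractions exhaust its skew-field of fractions, and these properties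
  determine \<open>'a\<close> with \<open>v\<close>, \<open>x1\<close>, \<open>x2\<close> up to unique isomorphism.
\<close>

definition skew_field_of_fractions_of_quantum_torus ::
    "'a::division_ring \<Rightarrow> 'a \<Rightarrow> 'a \<Rightarrow> bool" where
  "skew_field_of_fractions_of_quantum_torus v x1 x2 \<longleftrightarrow>
     v \<noteq> 0 \<and> x1 \<noteq> 0 \<and> x2 \<noteq> 0 \<and>
     (\<forall>y. v * y = y * v) \<and>
     x2 * x1 = v^2 * x1 * x2 \<and>
     laurent_basis v (\<lambda>(a::int, b::int). x1 powi a * x2 powi b) (quantum_torus v x1 x2) \<and>
     (\<forall>f. \<exists>p\<in>quantum_torus v x1 x2. \<exists>q\<in>quantum_torus v x1 x2. q \<noteq> 0 \<and> f = p * inverse q)"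

text \<open>
  The cluster variables of the coefficient-free quantum cluster algebra of type \<open>A\<^sub>1\<^sup>(\<^sup>1\<^sup>)\<close>, in the
  ambient skew-field \<open>'a\<close>. The exchange relations determine \<open>X\<close> from \<open>X 1\<close> and \<open>X 2\<close>.
  The initial seed has \<open>\<Lambda> = (0, -1; 1, 0)\<close>, \<open>B = (0, -2; 2, 0)\<close> and \<open>d\<^sub>1 = d\<^sub>2 = 2\<close>:
  \<open>\<Lambda>\<close> gives the relation \<open>X\<^sub>2 X\<^sub>1 = v\<^sup>2 X\<^sub>1 X\<^sub>2\<close>, and \<open>B\<close> the exchange relations.
\<close>

definition cluster_variables_A11 :: "'a::division_ring \<Rightarrow> (int \<Rightarrow> 'a) \<Rightarrow> bool" where
  "cluster_variables_A11 v X \<longleftrightarrow>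
     skew_field_of_fractions_of_quantum_torus v (X 1) (X 2) \<and>
     (\<forall>m. X (m + 1) * X (m - 1) = v^2 * (X m)^2 + 1)"

definition cluster_algebra :: "'a::division_ring \<Rightarrow> (int \<Rightarrow> 'a) \<Rightarrow> 'a set" where
  "cluster_algebra v X = laurent_subalgebra v (range X)"

definition is_bar_involution :: "'a::division_ring \<Rightarrow> (int \<Rightarrow> 'a) \<Rightarrow> ('a \<Rightarrow> 'a) \<Rightarrow> bool" where
  "is_bar_involution v X \<beta> \<longleftrightarrow>
     (\<forall>x\<in>cluster_algebra v X. \<beta> x \<in> cluster_algebra v X \<and> \<beta> (\<beta> x) = x) \<and>
     (\<forall>x\<in>cluster_algebra v X. \<forall>y\<in>cluster_algebra v X.
        \<beta> (x + y) = \<beta> x + \<beta> y \<and> \<beta> (x * y) = \<beta> y * \<beta> x) \<and>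
     \<beta> v = inverse v \<and>
     (\<forall>m. \<beta> (X m) = X m)"

text \<open>Extensionality makes the involution, which lives on the cluster algebra, unique as a HOL function.\<close>

definition bar :: "'a::division_ring \<Rightarrow> (int \<Rightarrow> 'a) \<Rightarrow> 'a \<Rightarrow> 'a" where
  "bar v X = (THE \<beta>. is_bar_involution v X \<beta> \<and> \<beta> \<in> extensional (cluster_algebra v X))"

text \<open>Note that \<open>nat c\<close> is \<open>[c]\<^sub>+ = max c 0\<close> as a natural number.\<close>

definition standard_elt :: "'a::division_ring \<Rightarrow> (int \<Rightarrow> 'a) \<Rightarrow> int \<times> int \<Rightarrow> 'a" where
  "standard_elt v X = (\<lambda>(a1, a2).
     v powi (a1 * a2) * X 3 ^ nat (- a1) * X 1 ^ nat a1 * X 2 ^ nat a2 * X 0 ^ nat (- a2))"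

text \<open>The direct sum of the \<open>v\<int>[v] E\<^sub>a\<close> over all \<open>a\<close>.\<close>

definition v_lattice :: "'a::division_ring \<Rightarrow> (int \<Rightarrow> 'a) \<Rightarrow> 'a set" where
  "v_lattice v X =
     {(\<Sum>a\<in>S. lscale v (p a) (standard_elt v X a)) | S p. finite S \<and> (\<forall>a\<in>S. p a \<in> v_Zv)}"

definition is_canonical_triangular_basis ::
    "'a::division_ring \<Rightarrow> (int \<Rightarrow> 'a) \<Rightarrow> (int \<times> int \<Rightarrow> 'a) \<Rightarrow> bool" where
  "is_canonical_triangular_basis v X C \<longleftrightarrow>
     laurent_basis v C (cluster_algebra v X) \<and>
     (\<forall>a. bar v X (C a) = C a) \<and>
     (\<forall>a. C a - standard_elt v X a \<in> v_lattice v X)"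

definition canonical_triangular_basis ::
    "'a::division_ring \<Rightarrow> (int \<Rightarrow> 'a) \<Rightarrow> int \<times> int \<Rightarrow> 'a" where
  "canonical_triangular_basis v X = (THE C. is_canonical_triangular_basis v X C)"

definition cluster_monomial :: "'a::division_ring \<Rightarrow> (int \<Rightarrow> 'a) \<Rightarrow> int \<Rightarrow> nat \<Rightarrow> nat \<Rightarrow> 'a" where
  "cluster_monomial v X m a1 a2 = v ^ (a1 * a2) * X m ^ a1 * X (m + 1) ^ a2"

definition X_delta :: "'a::division_ring \<Rightarrow> (int \<Rightarrow> 'a) \<Rightarrow> 'a" where
  "X_delta v X = v * X 3 * X 0 - v^3 * X 2 * X 1"

text \<open>
  Normalized Chebyshev polynomials of the second kind, evaluated at a ring element. The value
  \<open>S\<^sub>1(z) = z\<close> is the recursion step from \<open>S\<^sub>-\<^sub>1 = 0\<close> and \<open>S\<^sub>0 = 1\<close>.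
\<close>

fun chebyshev_S :: "nat \<Rightarrow> 'a::ring_1 \<Rightarrow> 'a" where
  "chebyshev_S 0 z = 1"
| "chebyshev_S (Suc 0) z = z"
| "chebyshev_S (Suc (Suc r)) z = z * chebyshev_S (Suc r) z - chebyshev_S r z"

end

theory Submission
  imports Defs
begin

text \<open>
  Cluster monomials and Chebyshev elements are indexed by \<open>(n, s)\<close>, degree and sum of indices;
  write \<open>b n s\<close> for them. Repeated use of
  \<open>X\<^sub>i\<^sub>+\<^sub>d\<^sub>+\<^sub>1 X\<^sub>i\<^sub>-\<^sub>1 = v\<^sup>2 X\<^sub>i\<^sub>+\<^sub>d X\<^sub>i + v\<^sup>-\<^sup>d S\<^sub>d(X\<^sub>\<delta>)\<close>, which moves two factors towards each
  other, shows that a suitable power of \<open>v\<close> times \<open>b n s X\<^sub>i\<close> is a single \<open>b n' s'\<close> modulo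
  \<open>v\<close> times the \<open>\<int>[v]\<close>-span of the \<open>b\<close>'s. Hence the \<open>b\<close>'s span the cluster algebra, and, since
  \<open>E(a\<^sub>1, a\<^sub>2 - 1) = v\<^sup>-\<^sup>a\<^sup>1 E(a\<^sub>1, a\<^sub>2) X\<^sub>0\<close> for \<open>a\<^sub>2 \<le> 0\<close>, every \<open>E(a)\<close> is congruent to some \<open>b\<close>
  modulo \<open>v\<close>. In the quantum torus both \<open>E(a)\<close> and this \<open>b\<close> have the lowest term
  \<open>v\<^sup>a\<^sup>1\<^sup>a\<^sup>2 X\<^sub>1\<^sup>a\<^sup>1 X\<^sub>2\<^sup>a\<^sup>2\<close>; so the \<open>b\<close>'s are independent and the congruences can be inverted triangularly.
  The elements \<open>b\<close> are bar-invariant because the \<open>X\<^sub>m\<close> and \<open>X\<^sub>\<delta>\<close> are, and a bar-invariant element of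
  the lattice spanned by the \<open>v E(a)\<close> over \<open>\<int>[v]\<close> vanishes, which gives uniqueness.
\<close>

section \<open>Lattices over the quantum parameter\<close>

text \<open>The obstacle is the control of powers of v. Rewriting b n s X_i produces products with
  other cluster variables, and each of them must again come out with non-negative powers of v, with
  a spare factor v wherever it is not leading. The device is \<open>ht\<close>, which records the
  denominators of b n s in every cluster at once; \<open>low\<close> expresses that denominators are
  subadditive under the rewriting. At the same time v^(ht n s i) is the factor that normalises b n s
  X_i: in the cluster of X_(i+1) and X_(i+2) the lowest term of X_i is X_(i+2)^-1, and multiplying
  the lowest term of b n s by it costs just that power. So one bound on denominators also bounds
  powers of v, and the same number is the induction measure. All clusters are needed because the
  rewriting moves i to its neighbours. For E(a) only X_0 is multiplied on; the two denominators in
  the initial cluster then give a coordinatewise order, well founded on the negative quadrant, the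
  only place where E(a) can differ from a basis element.\<close>

lemma laurent_single_mult_inverse:
  "Poly_Mapping.single k (1::int) * Poly_Mapping.single (- k :: int) 1 = 1"
  by (simp add: mult_single)

section \<open>Inverting the parameter in Laurent polynomials\<close>

definition laurent_bar :: "laurent \<Rightarrow> laurent" where
  "laurent_bar p = Poly_Mapping.map_key uminus p"

lemma lookup_laurent_bar: "Poly_Mapping.lookup (laurent_bar p) k = Poly_Mapping.lookup p (- k)"
  by (simp add: laurent_bar_def map_key.rep_eq)

lemma laurent_bar_add: "laurent_bar (p + q) = laurent_bar p + laurent_bar q"
  by (rule poly_mapping_eqI) (simp add: lookup_laurent_bar lookup_add)

lemma laurent_bar_diff: "laurent_bar (p - q) = laurent_bar p - laurent_bar q"
  by (rule poly_mapping_eqI) (simp add: lookup_laurent_bar lookup_minus)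

lemma laurent_bar_0 [simp]: "laurent_bar 0 = 0"
  by (rule poly_mapping_eqI) (simp add: lookup_laurent_bar)

lemma laurent_bar_bar [simp]: "laurent_bar (laurent_bar p) = p"
  by (rule poly_mapping_eqI) (simp add: lookup_laurent_bar)

lemma laurent_bar_single: "laurent_bar (Poly_Mapping.single k c) = Poly_Mapping.single (- k) c"
  by (rule poly_mapping_eqI) (auto simp: lookup_laurent_bar lookup_single when_def)

lemma laurent_bar_mult: "laurent_bar (p * q) = laurent_bar p * laurent_bar q"
proof -
  have single: "laurent_bar (Poly_Mapping.single i 1 * q) = Poly_Mapping.single (- i) 1 * laurent_bar q" for i
    using subset_UNIV[of "Poly_Mapping.keys q"]
  proof (induction q rule: frag_induction)
    case (one j)
    then show ?case by (simp add: mult_single laurent_bar_single)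
  qed (simp_all add: right_diff_distrib laurent_bar_diff)
  show ?thesis
    using subset_UNIV[of "Poly_Mapping.keys p"]
  proof (induction p rule: frag_induction)
    case (one j)
    then show ?case using single[of j] by (simp add: laurent_bar_single)
  qed (simp_all add: left_diff_distrib laurent_bar_diff)
qed

text \<open>Invariance makes the coefficients symmetric under k -> -k, and those at k \<le> 0
  vanish. This is what makes bar-invariance pin down the basis.\<close>

lemma laurent_bar_fixed_v_Zv:
  assumes "p \<in> v_Zv" "laurent_bar p = p"
  shows "p = 0"
proof (rule poly_mapping_eqI)
  fix k
  have nonpos: "Poly_Mapping.lookup p l = 0" if "l \<le> 0" for l
  proof (rule ccontr)
    assume "Poly_Mapping.lookup p l \<noteq> 0"
    then have "l \<in> Poly_Mapping.keys p"
      by (simp add: in_keys_iff)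
    then have "l > 0"
      using assms(1) unfolding v_Zv_def by blast
    with that show False by simp
  qed
  have "Poly_Mapping.lookup p k = Poly_Mapping.lookup p (- k)"
    using lookup_laurent_bar[of p k] unfolding assms(2) .
  then have "Poly_Mapping.lookup p k = 0"
    using nonpos[of k] nonpos[of "- k"] by (cases "k \<le> 0") (simp only:, simp only: neg_le_0_iff_le linear)
  then show "Poly_Mapping.lookup p k = Poly_Mapping.lookup 0 k"
    by simp
qed

locale central_unit =
  fixes v :: "'a::division_ring"
  assumes v_nonzero [simp]: "v \<noteq> 0"
    and v_central: "v * y = y * v"
begin

lemma power_int_central: "v powi k * y = y * v powi k"
proof (cases "k \<ge> 0")
  case True
  then show ?thesis
    using power_commuting_commutes[OF v_central] by (simp add: power_int_def)
next
  case False
  have "inverse v * y = y * inverse v"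
    using mult_commute_imp_mult_inverse_commute[OF v_central] by simp
  then show ?thesis
    using power_commuting_commutes[of "inverse v" y] False by (simp add: power_int_def)
qed

definition scale :: "int \<Rightarrow> 'a \<Rightarrow> 'a"  (infixr "\<odot>" 75)
  where "k \<odot> x = v powi k * x"

lemma scale_scale [simp]: "k \<odot> l \<odot> x = (k + l) \<odot> x"
  by (simp add: scale_def power_int_add mult.assoc)

lemma scale_0 [simp]: "0 \<odot> x = x"
  by (simp add: scale_def)

lemma scale_mult_left [simp]: "(k \<odot> x) * y = k \<odot> (x * y)"
  by (simp add: scale_def mult.assoc)

lemma scale_mult_right [simp]: "x * (k \<odot> y) = k \<odot> (x * y)"
proof -
  have "x * (v powi k * y) = (v powi k * x) * y"
    by (simp only: power_int_central mult.assoc)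
  then show ?thesis
    by (simp add: scale_def mult.assoc)
qed

lemma scale_zero_right [simp]: "k \<odot> 0 = 0"
  by (simp add: scale_def)

lemma scale_add: "k \<odot> (x + y) = k \<odot> x + k \<odot> y"
  by (simp add: scale_def distrib_left)

lemma scale_diff: "k \<odot> (x - y) = k \<odot> x - k \<odot> y"
  by (simp add: scale_def right_diff_distrib)

lemma scale_minus [simp]: "k \<odot> (- x) = - (k \<odot> x)"
  by (simp add: scale_def)

lemma scale_sum: "k \<odot> sum f S = (\<Sum>x\<in>S. k \<odot> f x)"
  by (simp add: scale_def sum_distrib_left)

lemma scale_cancel [simp]: "k \<odot> x = k \<odot> y \<longleftrightarrow> x = y"
  by (simp add: scale_def)

lemma scale_eq_iff: "k \<odot> x = y \<longleftrightarrow> x = (- k) \<odot> y"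
  by auto

lemma v_eq_scale: "v * x = 1 \<odot> x" "v ^ n * x = int n \<odot> x"
  by (simp_all add: scale_def)

lemma lscale_single: "lscale v (Poly_Mapping.single k 1) x = k \<odot> x"
  by (simp add: lscale_def eval_laurent_single scale_def)

text \<open>The \<open>\<int>[v]\<close>-submodule generated by \<open>G\<close>.\<close>

inductive_set lattice :: "'a set \<Rightarrow> 'a set" for G where
  zero: "0 \<in> lattice G"
| plus: "x \<in> lattice G \<Longrightarrow> g \<in> G \<Longrightarrow> k \<ge> 0 \<Longrightarrow> x + k \<odot> g \<in> lattice G"
| minus: "x \<in> lattice G \<Longrightarrow> g \<in> G \<Longrightarrow> k \<ge> 0 \<Longrightarrow> x - k \<odot> g \<in> lattice G"

lemma lattice_add:
  assumes "x \<in> lattice G" "y \<in> lattice G"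
  shows "x + y \<in> lattice G"
  using assms(2)
proof induction
  case zero
  then show ?case using assms(1) by simp
next
  case (plus y g k)
  then show ?case using lattice.plus[of "x + y"] by (simp add: add.assoc)
next
  case (minus y g k)
  then show ?case using lattice.minus[of "x + y"] by (simp add: algebra_simps)
qed

lemma lattice_uminus:
  assumes "x \<in> lattice G"
  shows "- x \<in> lattice G"
  using assms
proof induction
  case zero
  then show ?case using lattice.zero by simp
next
  case (plus y g k)
  then show ?case using lattice.minus[of "- y"] by (simp add: algebra_simps)
next
  case (minus y g k)
  then show ?case using lattice.plus[of "- y"] by (simp add: algebra_simps)
qed

lemma lattice_diff: "x \<in> lattice G \<Longrightarrow> y \<in> lattice G \<Longrightarrow> x - y \<in> lattice G"
  using lattice_add[of x G "- y"] lattice_uminus[of y] by simp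

lemma lattice_sum: "(\<And>i. i \<in> I \<Longrightarrow> f i \<in> lattice G) \<Longrightarrow> sum f I \<in> lattice G"
  by (induction I rule: infinite_finite_induct) (auto intro: lattice_add lattice.zero)

lemma lattice_gen: "g \<in> G \<Longrightarrow> k \<ge> 0 \<Longrightarrow> k \<odot> g \<in> lattice G"
  using lattice.plus[OF lattice.zero, of g G k] by simp

lemma lattice_base: "g \<in> G \<Longrightarrow> g \<in> lattice G"
  using lattice_gen[of g G 0] by simp

text \<open>Used with scaling, inclusion and right multiplication by a cluster variable as
  \<open>f\<close>, so that only multiples of generators have to be examined. The power
  \<open>k\<close> stays in the last premise because closure under such powers,
  \<open>lattice_scale\<close>, is itself derived from here.\<close>

lemma lattice_image:
  assumes x: "x \<in> lattice G"
    and f: "\<And>x y. f (x + y) = f x + f y" "\<And>k x. f (k \<odot> x) = k \<odot> f x"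
    and G: "\<And>g k. g \<in> G \<Longrightarrow> k \<ge> 0 \<Longrightarrow> k \<odot> f g \<in> lattice G'"
  shows "f x \<in> lattice G'"
proof -
  have "f 0 = 0"
    using f(1)[of 0 0] by simp
  moreover have "f (x - y) = f x - f y" for x y
    using f(1)[of "x - y" y] by simp
  ultimately have *: "f 0 = 0" "f (x - y) = f x - f y" for x y
    by blast+
  show ?thesis
    using x by induction (auto simp: f * intro: lattice.zero lattice_add lattice_diff G)
qed

lemma lattice_scale:
  assumes "x \<in> lattice G" "k \<ge> 0"
  shows "k \<odot> x \<in> lattice G"
  using assms
  by (intro lattice_image[where f = "\<lambda>x. k \<odot> x"])
     (auto simp: scale_add add.commute intro: lattice_gen)

lemma lattice_subset:
  assumes "G \<subseteq> lattice G'"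
  shows "lattice G \<subseteq> lattice G'"
proof
  fix x assume "x \<in> lattice G"
  then show "x \<in> lattice G'"
    using lattice_image[where f = "\<lambda>x. x" and G' = G'] assms lattice_scale by blast
qed

lemma lattice_mono: "G \<subseteq> G' \<Longrightarrow> lattice G \<subseteq> lattice G'"
  by (rule lattice_subset) (auto intro: lattice_base)

sublocale L: module "lscale v"
  by (rule module_lscale) simp

lemma lscale_eq: "lscale v p x = (\<Sum>k\<in>Poly_Mapping.keys p. of_int (Poly_Mapping.lookup p k) * (k \<odot> x))"
  by (simp add: lscale_def eval_laurent_def scale_def sum_distrib_right mult.assoc)

lemma mult_lscale: "x * lscale v p y = lscale v p (x * y)"
proof -
  have "x * (of_int n * y) = of_int n * (x * y)" for n y
    by (simp only: mult.assoc[symmetric] mult_of_int_commute[of n x])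
  then show ?thesis
    by (simp add: lscale_eq sum_distrib_left)
qed

lemma lscale_mult: "lscale v p x * y = lscale v p (x * y)"
  by (simp add: lscale_def mult.assoc)

lemma mult_power_int_commute:
  assumes "y * x = k \<odot> (x * y)" "x \<noteq> 0"
  shows "y * x powi c = (k * c) \<odot> (x powi c * y)"
proof -
  have *: "y * x ^ n = (k * int n) \<odot> (x ^ n * y)" if "y * x = k \<odot> (x * y)" for k n and x :: 'a
  proof (induction n)
    case (Suc n)
    have "y * x ^ Suc n = (y * x) * x ^ n"
      by (simp add: mult.assoc)
    also have "\<dots> = k \<odot> (x * (y * x ^ n))"
      by (simp add: that mult.assoc)
    finally show ?case
      by (simp add: Suc mult.assoc distrib_left)
  qed simp
  \<comment> \<open>Multiplying by \<open>inverse x\<close> on both sides turns the relation for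
    \<open>x\<close> into one for \<open>inverse x\<close> with the opposite exponent, so the result
    on natural powers covers negative ones too.\<close>
  have "inverse x * (y * x) * inverse x = inverse x * (k \<odot> (x * y)) * inverse x"
    by (simp add: assms)
  then have "inverse x * y = k \<odot> (y * inverse x)"
  proof -
    have "inverse x * (y * x) * inverse x = inverse x * y * (x * inverse x)"
      by (simp only: mult.assoc)
    moreover have "inverse x * (k \<odot> (x * y)) * inverse x = k \<odot> ((inverse x * x) * y * inverse x)"
      by (simp only: mult.assoc scale_mult_left scale_mult_right)
    ultimately show ?thesis
      using assms(2) \<open>inverse x * (y * x) * inverse x = inverse x * (k \<odot> (x * y)) * inverse x\<close> by simp
  qed
  then have "y * inverse x = (- k) \<odot> (inverse x * y)"
    by simp
  from *[OF this, of "nat (- c)"] *[OF assms(1), of "nat c"] show ?thesis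
    by (cases "c \<ge> 0") (simp_all add: power_int_def)
qed

lemma power_int_commute_scale:
  assumes "y * x = k \<odot> (x * y)" "x \<noteq> 0" "y \<noteq> 0"
  shows "y powi b * x powi c = (k * b * c) \<odot> (x powi c * y powi b)"
proof -
  have "y * x powi c = (k * c) \<odot> (x powi c * y)"
    by (rule mult_power_int_commute) fact+
  then have "x powi c * y = (- (k * c)) \<odot> (y * x powi c)"
    by simp
  from mult_power_int_commute[OF this \<open>y \<noteq> 0\<close>, of b] show ?thesis
    by (simp add: algebra_simps)
qed

text \<open>Coefficients are indexed by \<open>i\<close> and not by the values of \<open>b\<close>:
  a repeated value would give the relation b i - b j = 0, so this one condition carries both the
  injectivity and the independence demanded by \<open>laurent_basis\<close>.\<close>

definition independent_family :: "('i \<Rightarrow> 'a) \<Rightarrow> bool" where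
  "independent_family b \<longleftrightarrow>
     (\<forall>I p. finite I \<longrightarrow> (\<Sum>i\<in>I. lscale v (p i) (b i)) = 0 \<longrightarrow> (\<forall>i\<in>I. p i = 0))"

lemma independent_familyD:
  "independent_family b \<Longrightarrow> finite I \<Longrightarrow> (\<Sum>i\<in>I. lscale v (p i) (b i)) = 0 \<Longrightarrow> i \<in> I \<Longrightarrow> p i = 0"
  unfolding independent_family_def by blast

lemma independent_familyI:
  assumes "inj b" "\<not> L.dependent (range b)"
  shows "independent_family b"
  unfolding independent_family_def
proof (intro allI impI ballI)
  fix I p i assume *: "finite I" "(\<Sum>i\<in>I. lscale v (p i) (b i)) = 0" "i \<in> I"
  have "(\<Sum>x\<in>b ` I. lscale v (p (inv b x)) x) = 0"
    using assms(1) *(2) by (subst sum.reindex) (auto intro: inj_on_subset)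
  from L.independentD[OF assms(2) _ _ this, of "b i"] show "p i = 0"
    using assms * by auto
qed

lemma independent_family_inj:
  assumes "independent_family b"
  shows "inj b"
proof (rule injI, rule ccontr)
  fix i j assume *: "b i = b j" "i \<noteq> j"
  define p :: "'b \<Rightarrow> laurent" where "p k = (if k = i then 1 else - 1)" for k
  have "(\<Sum>k\<in>{i, j}. lscale v (p k) (b k)) = 0"
    using * by (simp add: p_def)
  from independent_familyD[OF assms _ this, of i] show False
    by (simp add: p_def)
qed

lemma independent_family_independent:
  assumes "independent_family b"
  shows "\<not> L.dependent (range b)"
  unfolding L.independent_explicit_module
proof (intro allI impI)
  fix t u x assume t: "finite t" "t \<subseteq> range b" "(\<Sum>v'\<in>t. lscale v (u v') v') = 0" "x \<in> t"
  have inj: "inj b" by (rule independent_family_inj) fact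
  have b: "b ` (b -` t) = t" using t(2) by auto
  have "(\<Sum>i\<in>b -` t. lscale v (u (b i)) (b i)) = (\<Sum>v'\<in>b ` (b -` t). lscale v (u v') v')"
    using inj by (subst sum.reindex) (auto intro: inj_on_subset)
  also have "\<dots> = 0" unfolding b by (rule t(3))
  finally have "(\<Sum>i\<in>b -` t. lscale v (u (b i)) (b i)) = 0" .
  moreover obtain i where "x = b i" using t by auto
  ultimately show "u x = 0"
    using independent_familyD[OF assms, of "b -` t" "\<lambda>i. u (b i)" i] t inj
    by (auto intro: finite_vimageI)
qed

lemma scale_in_span: "x \<in> L.span G \<Longrightarrow> k \<odot> x \<in> L.span G"
  using L.span_scale[of x G "Poly_Mapping.single k 1"] by (simp add: lscale_single)

lemma lattice_subset_span: "lattice G \<subseteq> L.span G"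
proof
  fix x assume "x \<in> lattice G"
  then show "x \<in> L.span G"
    by induction (auto intro: L.span_zero L.span_add L.span_diff L.span_base scale_in_span)
qed

definition nonneg_laurent :: "laurent set" where
  "nonneg_laurent = {p. \<forall>k\<in>Poly_Mapping.keys p. k \<ge> 0}"

lemma nonneg_laurent_0: "0 \<in> nonneg_laurent"
  by (simp add: nonneg_laurent_def)

lemma nonneg_laurent_add: "p \<in> nonneg_laurent \<Longrightarrow> q \<in> nonneg_laurent \<Longrightarrow> p + q \<in> nonneg_laurent"
  using Poly_Mapping.keys_add[of p q] unfolding nonneg_laurent_def by blast

lemma nonneg_laurent_single: "k \<ge> 0 \<Longrightarrow> Poly_Mapping.single k c \<in> nonneg_laurent"
  by (simp add: nonneg_laurent_def)

lemma lscale_lattice: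
  assumes "p \<in> nonneg_laurent" "x \<in> lattice G"
  shows "lscale v p x \<in> lattice G"
proof -
  have nat: "of_nat n * y \<in> lattice G" if "y \<in> lattice G" for n y
  proof (induction n)
    case (Suc n)
    have "of_nat (Suc n) * y = y + of_nat n * y"
      by (simp add: distrib_right)
    then show ?case
      using lattice_add[OF that Suc] by (simp only:)
  qed (simp add: lattice.zero)
  have int: "of_int n * y \<in> lattice G" if "y \<in> lattice G" for n y
  proof (cases n rule: int_cases2)
    case (nonneg m)
    then show ?thesis using nat[OF that, of m] by simp
  next
    case (nonpos m)
    then show ?thesis using lattice_uminus[OF nat[OF that, of m]] by simp
  qed
  show ?thesis
    unfolding lscale_eq
  proof (intro lattice_sum int)
    fix k assume "k \<in> Poly_Mapping.keys p"
    then show "k \<odot> x \<in> lattice G"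
      using assms by (intro lattice_scale) (auto simp: nonneg_laurent_def)
  qed
qed

text \<open>The inductive form of \<open>lattice\<close> serves inductions; this explicit form is
  the one to compare with \<open>v_lattice\<close>, and it allows comparing coefficients in an
  independent family.\<close>

lemma lattice_range:
  "lattice (range b) = {\<Sum>i\<in>I. lscale v (p i) (b i) | I p. finite I \<and> (\<forall>i\<in>I. p i \<in> nonneg_laurent)}"
  (is "_ = ?R")
proof (intro equalityI subsetI)
  have add: "x + lscale v r (b i) \<in> ?R" if x: "x \<in> ?R" and r: "r \<in> nonneg_laurent" for x r i
  proof -
    from x obtain I p where Ip: "x = (\<Sum>i\<in>I. lscale v (p i) (b i))" "finite I" "\<forall>i\<in>I. p i \<in> nonneg_laurent"
      by blast
    define p' where "p' j = (if j \<in> I then p j else 0)" for j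
    define q where "q j = p' j + (if j = i then r else 0)" for j
    have "(\<Sum>j\<in>insert i I. lscale v (q j) (b j)) =
        (\<Sum>j\<in>insert i I. lscale v (p' j) (b j)) + (\<Sum>j\<in>insert i I. lscale v (if j = i then r else 0) (b j))"
      by (simp only: q_def L.scale_left_distrib sum.distrib)
    also have "(\<Sum>j\<in>insert i I. lscale v (p' j) (b j)) = x"
      unfolding Ip(1) using Ip(2) by (intro sum.mono_neutral_cong_right) (auto simp: p'_def)
    also have "(\<Sum>j\<in>insert i I. lscale v (if j = i then r else 0) (b j)) = (\<Sum>j\<in>{i}. lscale v r (b j))"
      using Ip(2) by (intro sum.mono_neutral_cong_right) auto
    finally have "x + lscale v r (b i) = (\<Sum>j\<in>insert i I. lscale v (q j) (b j))"
      by simp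
    moreover have "\<forall>j\<in>insert i I. q j \<in> nonneg_laurent"
      using Ip(3) r by (auto simp: q_def p'_def intro: nonneg_laurent_add nonneg_laurent_0)
    ultimately show ?thesis
      using Ip(2) by blast
  qed
  fix x assume "x \<in> lattice (range b)"
  then show "x \<in> ?R"
  proof induction
    case zero
    show ?case by (intro CollectI exI[of _ "{}"] exI[of _ "\<lambda>_. 0"]) simp
  next
    case (plus x g k)
    then obtain i where "g = b i" by blast
    with add[OF plus.IH nonneg_laurent_single[OF plus(3), of 1], of i] show ?case
      by (simp only: lscale_single)
  next
    case (minus x g k)
    then obtain i where g: "g = b i" by blast
    have "lscale v (Poly_Mapping.single k (-1)) (b i) = - (k \<odot> b i)"
      by (simp add: lscale_def eval_laurent_single scale_def)
    with add[OF minus.IH nonneg_laurent_single[OF minus(3), of "-1"], of i] g show ?case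
      by (simp only: diff_conv_add_uminus)
  qed
next
  fix x assume "x \<in> ?R"
  then obtain I p where Ip: "x = (\<Sum>i\<in>I. lscale v (p i) (b i))" "\<And>i. i \<in> I \<Longrightarrow> p i \<in> nonneg_laurent"
    by blast
  show "x \<in> lattice (range b)"
    unfolding Ip(1) by (intro lattice_sum lscale_lattice Ip(2) lattice_base) auto
qed

end

section \<open>Products with a cluster variable\<close>

text \<open>The relations are invariant under shifting \<open>m\<close>, so no cluster is
  distinguished, and under reversing all products while inverting v. The element \<open>z\<close>
  enters through two linear recursions, which linearise the exchange relations.\<close>

locale kronecker = central_unit +
  fixes X :: "int \<Rightarrow> 'a" and z :: 'a
  assumes X_nonzero: "X m \<noteq> 0"
    and commutation: "X (m + 1) * X m = 2 \<odot> (X m * X (m + 1))"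
    and exchange: "X (m + 1) * X (m - 1) = 2 \<odot> X m ^ 2 + 1"
    and exchange': "X (m - 1) * X (m + 1) = (-2) \<odot> X m ^ 2 + 1"
    and z_left: "z * X m = 1 \<odot> X (m + 1) + (-1) \<odot> X (m - 1)"
    and z_right: "X m * z = (-1) \<odot> X (m + 1) + 1 \<odot> X (m - 1)"
begin

abbreviation S :: "nat \<Rightarrow> 'a" where "S r \<equiv> chebyshev_S r z"

section \<open>Products of cluster variables with each other and with Chebyshev polynomials\<close>

lemma S_commute: "S r * z = z * S r"
proof (induction r rule: less_induct)
  case (less r)
  consider "r = 0" | "r = 1" | e where "r = Suc (Suc e)"
    by (metis One_nat_def not0_implies_Suc)
  then show ?case
  proof cases
    case 3
    with less[of e] less[of "Suc e"] show ?thesis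
      by (simp add: left_diff_distrib right_diff_distrib mult.assoc)
  qed simp_all
qed

text \<open>For \<open>d = 0\<close> this is the exchange relation. Left multiplication by
  \<open>z\<close> raises \<open>d\<close> by one, and the Chebyshev recursion absorbs the
  inhomogeneous term.\<close>

lemma X_mult_far:
  "X (i + int d + 1) * X (i - 1) = 2 \<odot> (X (i + int d) * X i) + (- int d) \<odot> S d"
proof (induction d rule: less_induct)
  case (less d)
  have step: "1 \<odot> (X (k + 1) * X (i - 1)) + (-1) \<odot> (X (k - 1) * X (i - 1)) =
      3 \<odot> (X k * X i) + 1 \<odot> (X (k - 2) * X i) + a \<odot> (z * y)"
    if "X k * X (i - 1) = 2 \<odot> (X (k - 1) * X i) + a \<odot> y" for k a y
  proof -
    have "(1 \<odot> X (k + 1) + (-1) \<odot> X (k - 1)) * X (i - 1) = z * (X k * X (i - 1))"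
      by (simp only: mult.assoc[symmetric] z_left)
    also have "\<dots> = 2 \<odot> ((z * X (k - 1)) * X i) + a \<odot> (z * y)"
      by (simp add: that distrib_left mult.assoc)
    also have "z * X (k - 1) = 1 \<odot> X k + (-1) \<odot> X (k - 2)"
      by (simp add: z_left)
    finally show ?thesis
      by (simp add: distrib_right scale_add)
  qed
  consider "d = 0" | "d = 1" | e where "d = Suc (Suc e)"
    by (metis One_nat_def not0_implies_Suc)
  then show ?case
  proof cases
    case 1
    then show ?thesis using exchange[of i] by (simp add: power2_eq_square)
  next
    case 2
    \<comment> \<open>At \<open>d = 1\<close> the two unwanted terms, multiples of X i X (i - 1) and
      X (i - 1) X i, cancel by \<open>commutation\<close>. From \<open>d = 2\<close> on they are
      removed by the instance two steps below.\<close>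
    have "X (i + 1) * X (i - 1) = 2 \<odot> (X i * X i) + 0 \<odot> 1"
      using exchange[of i] by (simp add: power2_eq_square)
    with step[of "i + 1" 0 1] commutation[of "i - 1"]
    have "1 \<odot> (X (i + 2) * X (i - 1)) = 3 \<odot> (X (i + 1) * X i) + z"
      by (simp add: scale_add add.commute[of 2])
    then have "(-1) \<odot> 1 \<odot> (X (i + 2) * X (i - 1)) = (-1) \<odot> (3 \<odot> (X (i + 1) * X i) + z)"
      by (simp only:)
    with 2 show ?thesis
      by (simp add: scale_add add.commute[of 2])
  next
    case 3
    have idx: "i + int e + 2 + 1 = i + int e + 3" "i + int e + 2 - 1 = i + int e + 1" "i + int e + 2 - 2 = i + int e"
      by simp_all
    have a: "X (i + int e + 1) * X (i - 1) = 2 \<odot> (X (i + int e) * X i) + (- int e) \<odot> S e"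
      using less[of e] 3 by simp
    have b: "X (i + int e + 2) * X (i - 1) = 2 \<odot> (X (i + int e + 1) * X i) + (- int (Suc e)) \<odot> S (Suc e)"
      using less[of "Suc e"] 3 by (simp add: add.commute add.left_commute)
    have "1 \<odot> (X (i + int e + 3) * X (i - 1)) + (-1) \<odot> (X (i + int e + 1) * X (i - 1)) =
      3 \<odot> (X (i + int e + 2) * X i) + 1 \<odot> (X (i + int e) * X i) + (- int (Suc e)) \<odot> (z * S (Suc e))"
      by (rule step[of "i + int e + 2" "- int (Suc e)" "S (Suc e)", unfolded idx, OF b])
    then have "1 \<odot> (X (i + int e + 3) * X (i - 1)) =
      3 \<odot> (X (i + int e + 2) * X i) + (- int (Suc e)) \<odot> S (Suc (Suc e))"
      unfolding a by (simp add: scale_add scale_diff algebra_simps)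
    then have "(-1) \<odot> 1 \<odot> (X (i + int e + 3) * X (i - 1)) =
      (-1) \<odot> (3 \<odot> (X (i + int e + 2) * X i) + (- int (Suc e)) \<odot> S (Suc (Suc e)))"
      by (simp only:)
    then show ?thesis
      by (simp add: scale_add 3 add.assoc add.commute add.left_commute del: chebyshev_S.simps)
  qed
qed

text \<open>The mirror image of \<open>X_mult_far\<close>: all products are reversed and v is
  inverted, so \<open>z\<close> now multiplies from the right.\<close>

lemma X_mult_far':
  "X (i - 1) * X (i + int d + 1) = (-2) \<odot> (X i * X (i + int d)) + int d \<odot> S d"
proof (induction d rule: less_induct)
  case (less d)
  have step: "(-1) \<odot> (X (i - 1) * X (k + 1)) + 1 \<odot> (X (i - 1) * X (k - 1)) =
      (-3) \<odot> (X i * X k) + (-1) \<odot> (X i * X (k - 2)) + a \<odot> (y * z)"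
    if "X (i - 1) * X k = (-2) \<odot> (X i * X (k - 1)) + a \<odot> y" for k a y
  proof -
    have "X (i - 1) * ((-1) \<odot> X (k + 1) + 1 \<odot> X (k - 1)) = (X (i - 1) * X k) * z"
      by (simp only: mult.assoc z_right)
    also have "\<dots> = (-2) \<odot> (X i * (X (k - 1) * z)) + a \<odot> (y * z)"
      by (simp add: that distrib_right mult.assoc)
    also have "X (k - 1) * z = (-1) \<odot> X k + 1 \<odot> X (k - 2)"
      by (simp add: z_right)
    finally show ?thesis
      by (simp add: distrib_left scale_add)
  qed
  consider "d = 0" | "d = 1" | e where "d = Suc (Suc e)"
    by (metis One_nat_def not0_implies_Suc)
  then show ?case
  proof cases
    case 1
    then show ?thesis using exchange'[of i] by (simp add: power2_eq_square)
  next
    case 2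
    have "X (i - 1) * X (i + 1) = (-2) \<odot> (X i * X i) + 0 \<odot> 1"
      using exchange'[of i] by (simp add: power2_eq_square)
    with step[of "i + 1" 0 1] commutation[of "i - 1"]
    have "(-1) \<odot> (X (i - 1) * X (i + 2)) = (-3) \<odot> (X i * X (i + 1)) + z"
      by (simp add: scale_add add.commute[of 2])
    then have "1 \<odot> (-1) \<odot> (X (i - 1) * X (i + 2)) = 1 \<odot> ((-3) \<odot> (X i * X (i + 1)) + z)"
      by (simp only:)
    with 2 show ?thesis
      by (simp add: scale_add add.commute[of 2])
  next
    case 3
    have idx: "i + int e + 2 + 1 = i + int e + 3" "i + int e + 2 - 1 = i + int e + 1" "i + int e + 2 - 2 = i + int e"
      by simp_all
    have a: "X (i - 1) * X (i + int e + 1) = (-2) \<odot> (X i * X (i + int e)) + int e \<odot> S e"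
      using less[of e] 3 by simp
    have b: "X (i - 1) * X (i + int e + 2) = (-2) \<odot> (X i * X (i + int e + 1)) + int (Suc e) \<odot> S (Suc e)"
      using less[of "Suc e"] 3 by (simp add: add.commute add.left_commute)
    have "(-1) \<odot> (X (i - 1) * X (i + int e + 3)) + 1 \<odot> (X (i - 1) * X (i + int e + 1)) =
      (-3) \<odot> (X i * X (i + int e + 2)) + (-1) \<odot> (X i * X (i + int e)) + int (Suc e) \<odot> (S (Suc e) * z)"
      by (rule step[of "i + int e + 2" "int (Suc e)" "S (Suc e)", unfolded idx, OF b])
    then have "(-1) \<odot> (X (i - 1) * X (i + int e + 3)) =
      (-3) \<odot> (X i * X (i + int e + 2)) + int (Suc e) \<odot> S (Suc (Suc e))"
      unfolding a by (simp add: scale_add scale_diff S_commute algebra_simps)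
    then have "1 \<odot> (-1) \<odot> (X (i - 1) * X (i + int e + 3)) =
      1 \<odot> ((-3) \<odot> (X i * X (i + int e + 2)) + int (Suc e) \<odot> S (Suc (Suc e)))"
      by (simp only:)
    then show ?thesis
      by (simp add: scale_add 3 add.assoc add.commute add.left_commute del: chebyshev_S.simps)
  qed
qed

text \<open>Right multiplication by \<open>z\<close> acts on the cluster variables as T + T^-1,
  where T sends X m to v^-1 X (m + 1); and S r evaluated at T + T^-1 is the sum of the powers T^(r -
  2t).\<close>

lemma X_mult_S: "X m * S r = (\<Sum>t\<le>r. (2 * int t - int r) \<odot> X (m + int r - 2 * int t))"
proof (induction r rule: less_induct)
  case (less r)
  consider "r = 0" | "r = 1" | e where "r = Suc (Suc e)"
    by (metis One_nat_def not0_implies_Suc)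
  then show ?case
  proof cases
    case 3
    have "X m * S r = (X m * S (Suc e)) * z - X m * S e"
      by (simp add: 3 right_diff_distrib mult.assoc S_commute)
    also have "X m * S (Suc e) = (\<Sum>t\<le>Suc e. (2 * int t - int e - 1) \<odot> X (m + int e + 1 - 2 * int t))"
      using less[of "Suc e"] 3 by (simp add: algebra_simps del: sum.atMost_Suc)
    also have "\<dots> * z = (\<Sum>t\<le>Suc e. (2 * int t - int e - 2) \<odot> X (m + int e + 2 - 2 * int t))
        + (\<Sum>t\<le>Suc e. (2 * int t - int e) \<odot> X (m + int e - 2 * int t))"
      unfolding sum_distrib_right sum.distrib[symmetric]
    proof (intro sum.cong refl)
      fix t
      have "X (m + int e + 1 - 2 * int t) * z =
          (-1) \<odot> X (m + int e + 2 - 2 * int t) + 1 \<odot> X (m + int e - 2 * int t)"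
        using z_right[of "m + int e + 1 - 2 * int t"] by (simp add: algebra_simps)
      then show "(2 * int t - int e - 1) \<odot> X (m + int e + 1 - 2 * int t) * z =
          (2 * int t - int e - 2) \<odot> X (m + int e + 2 - 2 * int t) + (2 * int t - int e) \<odot> X (m + int e - 2 * int t)"
        by (simp add: scale_add)
    qed
    \<comment> \<open>All summands but the last form X m * S e, which the Chebyshev recursion
      subtracts again; the last one is the new summand at \<open>t = r\<close>.\<close>
    also have "(\<Sum>t\<le>Suc e. (2 * int t - int e) \<odot> X (m + int e - 2 * int t)) =
        X m * S e + (int e + 2) \<odot> X (m - int e - 2)"
      using less[of e] 3 by (simp add: algebra_simps)
    finally show ?thesis
      using 3 by (simp add: algebra_simps)
  qed (simp_all add: z_right)
qed

lemma S_mult_X: "S r * X m = (\<Sum>t\<le>r. (int r - 2 * int t) \<odot> X (m + int r - 2 * int t))"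
proof (induction r rule: less_induct)
  case (less r)
  consider "r = 0" | "r = 1" | e where "r = Suc (Suc e)"
    by (metis One_nat_def not0_implies_Suc)
  then show ?case
  proof cases
    case 3
    have "S r * X m = z * (S (Suc e) * X m) - S e * X m"
      by (simp add: 3 left_diff_distrib mult.assoc)
    also have "S (Suc e) * X m = (\<Sum>t\<le>Suc e. (int e + 1 - 2 * int t) \<odot> X (m + int e + 1 - 2 * int t))"
      using less[of "Suc e"] 3 by (simp add: algebra_simps del: sum.atMost_Suc)
    also have "z * \<dots> = (\<Sum>t\<le>Suc e. (int e + 2 - 2 * int t) \<odot> X (m + int e + 2 - 2 * int t))
        + (\<Sum>t\<le>Suc e. (int e - 2 * int t) \<odot> X (m + int e - 2 * int t))"
      unfolding sum_distrib_left sum.distrib[symmetric]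
    proof (intro sum.cong refl)
      fix t
      have "z * X (m + int e + 1 - 2 * int t) =
          1 \<odot> X (m + int e + 2 - 2 * int t) + (-1) \<odot> X (m + int e - 2 * int t)"
        using z_left[of "m + int e + 1 - 2 * int t"] by (simp add: algebra_simps)
      then show "z * (int e + 1 - 2 * int t) \<odot> X (m + int e + 1 - 2 * int t) =
          (int e + 2 - 2 * int t) \<odot> X (m + int e + 2 - 2 * int t) + (int e - 2 * int t) \<odot> X (m + int e - 2 * int t)"
        by (simp add: scale_add algebra_simps)
    qed
    also have "(\<Sum>t\<le>Suc e. (int e - 2 * int t) \<odot> X (m + int e - 2 * int t)) =
        S e * X m + (- int e - 2) \<odot> X (m - int e - 2)"
      using less[of e] 3 by (simp add: algebra_simps)
    finally show ?thesis
      using 3 by (simp add: algebra_simps)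
  qed (simp_all add: z_left)
qed

lemma power_commutation: "X (m + 1) ^ q * X m ^ p = (2 * int p * int q) \<odot> (X m ^ p * X (m + 1) ^ q)"
proof -
  have 1: "X (m + 1) * X m ^ p = (2 * int p) \<odot> (X m ^ p * X (m + 1))" for p
  proof (induction p)
    case (Suc p)
    have "X (m + 1) * X m ^ Suc p = (X (m + 1) * X m) * X m ^ p"
      by (simp add: mult.assoc)
    also have "\<dots> = 2 \<odot> (X m * (X (m + 1) * X m ^ p))"
      by (simp add: commutation mult.assoc)
    finally show ?case
      by (simp add: Suc mult.assoc distrib_left)
  qed simp
  show ?thesis
  proof (induction q)
    case (Suc q)
    have "X (m + 1) ^ Suc q * X m ^ p = X (m + 1) * (X (m + 1) ^ q * X m ^ p)"
      by (simp add: mult.assoc)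
    also have "\<dots> = (2 * int p * int q) \<odot> (X (m + 1) * X m ^ p * X (m + 1) ^ q)"
      by (simp add: Suc mult.assoc)
    finally show ?case
      unfolding 1 by (simp add: mult.assoc algebra_simps)
  qed simp
qed

section \<open>Normalised cluster monomials and their denominators\<close>

lemma cluster_monomial_eq:
  "cluster_monomial v X m p q = (int p * int q) \<odot> (X m ^ p * X (m + 1) ^ q)"
  by (simp add: cluster_monomial_def v_eq_scale(2) mult.assoc)

lemma cluster_monomial_eq':
  "cluster_monomial v X m p q = (- int p * int q) \<odot> (X (m + 1) ^ q * X m ^ p)"
  by (simp add: cluster_monomial_eq power_commutation)

text \<open>
  A cluster monomial is determined by its degree \<open>n\<close> and the sum \<open>s\<close> of the indices of
  its factors; \<open>n = 0\<close> is used for the Chebyshev polynomials.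
\<close>

definition basis_elt :: "nat \<Rightarrow> int \<Rightarrow> 'a" where
  "basis_elt n s =
     (if n = 0 then S (nat \<bar>s\<bar>)
      else cluster_monomial v X (s div int n) (n - nat (s mod int n)) (nat (s mod int n)))"

lemma basis_elt_monomial:
  "basis_elt (p + q) (m * int (p + q) + int q) = cluster_monomial v X m p q"
proof (cases "p = 0")
  case True
  then show ?thesis
    by (cases "q = 0") (simp_all add: basis_elt_def cluster_monomial_def distrib_right[symmetric])
next
  case False
  then have "(m * int (p + q) + int q) div int (p + q) = m" "(m * int (p + q) + int q) mod int (p + q) = int q"
    by (simp_all add: div_pos_pos_trivial)
  with False show ?thesis
    unfolding basis_elt_def by simp
qed

lemma basis_elt_monomial_eq:
  "n = p + q \<Longrightarrow> s = m * int (p + q) + int q \<Longrightarrow> basis_elt n s = cluster_monomial v X m p q"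
  by (simp only: basis_elt_monomial)

lemma basis_elt_0: "basis_elt 0 s = S (nat \<bar>s\<bar>)"
  by (simp add: basis_elt_def)

lemma basis_elt_1: "basis_elt 1 m = X m"
  using basis_elt_monomial[of 1 0 m] by (simp add: cluster_monomial_def)

text \<open>A factor X m of smallest index is split off to the right; \<open>q \<le> k\<close>
  guarantees that there is one. For \<open>k = 0\<close> what remains is S 0 = 1.\<close>

lemma basis_elt_Suc:
  assumes "q \<le> k"
  shows "basis_elt (Suc k) (m * (int k + 1) + int q) =
           (- int q) \<odot> (basis_elt k (m * int k + int q) * X m)"
proof -
  define p where "p = k - q"
  then have k: "k = p + q" using assms by simp
  have "basis_elt (Suc k) (m * (int k + 1) + int q) = cluster_monomial v X m (Suc p) q"
    by (rule basis_elt_monomial_eq) (simp_all add: k)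
  moreover have "basis_elt k (m * int k + int q) = cluster_monomial v X m p q"
    by (rule basis_elt_monomial_eq) (simp_all add: k)
  ultimately show ?thesis
    by (simp add: cluster_monomial_eq' power_Suc2 mult.assoc algebra_simps del: power_Suc)
qed

lemma decompose:
  obtains m q where "q \<le> k" "s = m * (int k + 1) + int q"
proof
  show "nat (s mod (int k + 1)) \<le> k"
    using pos_mod_bound[of "int k + 1" s] by simp
  show "s = s div (int k + 1) * (int k + 1) + int (nat (s mod (int k + 1)))"
    using div_mult_mod_eq[of s "int k + 1"] by simp
qed

text \<open>
  Up to sign, \<open>ht n s j\<close> is the lowest exponent of \<open>X\<^sub>j\<^sub>+\<^sub>1\<close> in the Laurent expansion of
  \<open>basis_elt n s\<close> in the cluster \<open>{X\<^sub>j\<^sub>+\<^sub>1, X\<^sub>j\<^sub>+\<^sub>2}\<close>.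
\<close>

definition ht :: "nat \<Rightarrow> int \<Rightarrow> int \<Rightarrow> int" where
  "ht n s j = \<bar>s - int n * (j + 1)\<bar> - int n"

lemma ht_1: "ht 1 i j = \<bar>i - j - 1\<bar> - 1"
  by (simp add: ht_def algebra_simps)

text \<open>With D = m - j - 1 and 0 \<le> q \<le> k, the numbers D and k D + q never have opposite
  signs, so their absolute values add: denominators are additive within a cluster.\<close>

lemma ht_Suc:
  assumes "q \<le> k"
  shows "ht (Suc k) (m * (int k + 1) + int q) j = ht k (m * int k + int q) j + ht 1 m j"
proof -
  define D where "D = m - j - 1"
  have eq: "m * (int k + 1) + int q - int (Suc k) * (j + 1) = (int k * D + int q) + D"
       "m * int k + int q - int k * (j + 1) = int k * D + int q"
    by (simp_all add: D_def algebra_simps)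
  have "\<bar>(int k * D + int q) + D\<bar> = \<bar>int k * D + int q\<bar> + \<bar>D\<bar>"
  proof (cases "D \<ge> 0")
    case True
    then have "int k * D \<ge> 0" by simp
    with True show ?thesis by simp
  next
    case False
    then have "int k * D \<le> int k * (- 1)"
      by (intro mult_left_mono) auto
    with False assms show ?thesis by simp
  qed
  then show ?thesis
    unfolding ht_def eq by (simp add: D_def algebra_simps)
qed

text \<open>The bound is imposed for all \<open>j\<close> because the power of v that multiplication
  by X i requires is governed by the value at \<open>j = i\<close>, and rewriting a product changes
  \<open>i\<close>.\<close>

definition low :: "(int \<Rightarrow> int) \<Rightarrow> 'a set" where
  "low H = lattice {basis_elt n s | n s. \<forall>j. ht n s j \<le> H j}"

lemma low_mono: "(\<And>j. H j \<le> H' j) \<Longrightarrow> low H \<subseteq> low H'"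
  unfolding low_def by (rule lattice_mono) (use order_trans in blast)

lemma low_basis_elt: "(\<And>j. ht n s j \<le> H j) \<Longrightarrow> basis_elt n s \<in> low H"
  unfolding low_def by (rule lattice_base) blast

lemmas low_add = lattice_add[of _ "{basis_elt n s | n s. \<forall>j. ht n s j \<le> H j}" for H, folded low_def]
lemmas low_sum = lattice_sum[of _ _ "{basis_elt n s | n s. \<forall>j. ht n s j \<le> H j}" for H, folded low_def]
lemmas low_scale = lattice_scale[of _ "{basis_elt n s | n s. \<forall>j. ht n s j \<le> H j}" for H, folded low_def]

lemma low_cong_scale: "x \<in> low H \<Longrightarrow> (\<And>j. H j \<le> H' j) \<Longrightarrow> k \<ge> 0 \<Longrightarrow> k \<odot> x \<in> low H'"
  using low_mono low_scale by blast

text \<open>The basis element whose lowest term in the cluster of X (i + 1) and X (i + 2) is that of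
  the product with X i: at \<open>i\<close> and at \<open>i + 1\<close> its \<open>ht\<close> is the
  sum of those of the factors. For n > 0 the degree drops when the mean index s / n exceeds i + 1;
  there the constant or Chebyshev term of the exchange dominates.\<close>

definition leading_elt :: "nat \<Rightarrow> int \<Rightarrow> int \<Rightarrow> 'a" where
  "leading_elt n s i =
     (if n = 0 then basis_elt 1 (i - \<bar>s\<bar>)
      else if int n * (i + 1) < s then basis_elt (n - 1) (s - i - 2)
      else basis_elt (n + 1) (s + i))"

lemma leading_elt_low: "leading_elt n s i \<in> low (\<lambda>j. ht n s j + ht 1 i j)"
proof -
  consider "n = 0" | "n > 0" "int n * (i + 1) < s" | "n > 0" "s \<le> int n * (i + 1)"
    by linarith
  then show ?thesis
  proof cases
    case 1
    then show ?thesis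
      by (auto simp: leading_elt_def ht_def intro!: low_basis_elt)
  next
    case 2
    have "ht (n - 1) (s - i - 2) j \<le> ht n s j + ht 1 i j" for j
    proof -
      define B where "B = i - j"
      define A where "A = s - int n * (j + 1)"
      have "int n * (i + 1) = int n * (j + 1) + int n * B"
        by (simp add: B_def algebra_simps)
      then have "int n * B < A"
        using 2 by (simp add: A_def)
      moreover have "int n * B \<ge> B" if "B \<ge> 0"
        using mult_right_mono[of 1 "int n" B] 2 that by simp
      ultimately have "\<bar>A - B - 1\<bar> + 2 \<le> \<bar>A\<bar> + \<bar>B - 1\<bar>"
        by (smt (verit) mult_nonneg_nonneg of_nat_0_le_iff)
      moreover have "s - i - 2 - int (n - 1) * (j + 1) = A - B - 1"
        using 2 by (simp add: A_def B_def of_nat_diff algebra_simps)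
      ultimately show ?thesis
        using 2 unfolding ht_1 by (simp add: ht_def A_def[symmetric] B_def of_nat_diff)
    qed
    with 2 show ?thesis
      by (auto simp: leading_elt_def intro!: low_basis_elt)
  next
    case 3
    have "ht (n + 1) (s + i) j \<le> ht n s j + ht 1 i j" for j
      unfolding ht_1 by (simp add: ht_def algebra_simps)
    with 3 show ?thesis
      by (auto simp: leading_elt_def intro!: low_basis_elt)
  qed
qed

text \<open>The exponent \<open>ht n s i\<close> is the one that gives the product a lowest term
  with normalised coefficient in the cluster of X (i + 1) and X (i + 2); this is why the leading
  element can occur with coefficient 1.\<close>

definition good :: "nat \<Rightarrow> int \<Rightarrow> int \<Rightarrow> bool" where
  "good n s i \<longleftrightarrow>
     (\<exists>y\<in>low (\<lambda>j. ht n s j + ht 1 i j).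
        ht n s i \<odot> (basis_elt n s * X i) = leading_elt n s i + 1 \<odot> y)"

lemma goodE:
  assumes "good n s i"
  obtains y where "y \<in> low (\<lambda>j. ht n s j + ht 1 i j)"
    "\<And>k. k \<odot> (basis_elt n s * X i) = (k - ht n s i) \<odot> (leading_elt n s i + 1 \<odot> y)"
proof -
  from assms obtain y where y: "y \<in> low (\<lambda>j. ht n s j + ht 1 i j)"
    "ht n s i \<odot> (basis_elt n s * X i) = leading_elt n s i + 1 \<odot> y"
    unfolding good_def by blast
  have "k \<odot> (basis_elt n s * X i) = (k - ht n s i) \<odot> (leading_elt n s i + 1 \<odot> y)" for k
    unfolding y(2)[symmetric] by simp
  with y(1) that show thesis by blast
qed

lemma good_low:
  assumes "good n s i" "k \<ge> ht n s i" "\<And>j. ht n s j + ht 1 i j \<le> H j"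
  shows "k \<odot> (basis_elt n s * X i) \<in> low H"
proof -
  obtain y where y: "y \<in> low (\<lambda>j. ht n s j + ht 1 i j)"
    "\<And>k. k \<odot> (basis_elt n s * X i) = (k - ht n s i) \<odot> (leading_elt n s i + 1 \<odot> y)"
    using goodE[OF assms(1)] by blast
  show ?thesis
    unfolding y(2)
    by (intro low_cong_scale[OF low_add[OF leading_elt_low low_scale[OF y(1)]]]) (use assms in auto)
qed

text \<open>Extends \<open>good_low\<close> from basis elements to their combinations: H i bounds
  \<open>ht n s i\<close> for all of them, so the single exponent \<open>k\<close> serves them
  all.\<close>

lemma low_mult_X:
  assumes "y \<in> low H" "\<And>n s. (\<And>j. ht n s j \<le> H j) \<Longrightarrow> good n s i"
    and "k \<ge> H i" "\<And>j. H j + ht 1 i j \<le> H' j"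
  shows "k \<odot> (y * X i) \<in> low H'"
  unfolding low_def
proof (rule lattice_image[where f = "\<lambda>y. k \<odot> (y * X i)"])
  show "y \<in> lattice {basis_elt n s | n s. \<forall>j. ht n s j \<le> H j}"
    using assms(1) by (simp add: low_def)
next
  fix g k' assume "g \<in> {basis_elt n s | n s. \<forall>j. ht n s j \<le> H j}" "k' \<ge> (0::int)"
  then obtain n s where g: "g = basis_elt n s" "\<And>j. ht n s j \<le> H j"
    by blast
  have "(k' + k) \<odot> (basis_elt n s * X i) \<in> low H'"
  proof (rule good_low)
    show "good n s i" by (rule assms(2)) (rule g)
    show "ht n s i \<le> k' + k" using g(2)[of i] assms(3) \<open>k' \<ge> 0\<close> by linarith
    show "ht n s j + ht 1 i j \<le> H' j" for j using g(2)[of j] assms(4)[of j] by linarith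
  qed
  then show "k' \<odot> k \<odot> (g * X i) \<in> lattice {basis_elt n s | n s. \<forall>j. ht n s j \<le> H' j}"
    by (simp add: g low_def)
qed (simp_all add: distrib_right scale_add add.commute)

lemma good_0: "good 0 s i"
proof -
  define r where "r = nat \<bar>s\<bar>"
  define y where "y = (\<Sum>t<r. (2 * int r - 2 * int t - 1) \<odot> basis_elt 1 (i + int r - 2 * int t))"
  \<comment> \<open>After multiplication by v^r the exponents are 2r - 2t, positive except at
    \<open>t = r\<close>, so a factor v splits off from all other summands.\<close>
  have "int r \<odot> (S r * X i) = (\<Sum>t\<le>r. (2 * int r - 2 * int t) \<odot> basis_elt 1 (i + int r - 2 * int t))"
    unfolding S_mult_X scale_sum basis_elt_1 by (intro sum.cong refl) simp
  also have "{..r} = insert r {..<r}" by auto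
  also have "(\<Sum>t\<in>\<dots>. (2 * int r - 2 * int t) \<odot> basis_elt 1 (i + int r - 2 * int t)) = basis_elt 1 (i - int r) + 1 \<odot> y"
    by (simp add: y_def scale_sum)
  finally have "ht 0 s i \<odot> (basis_elt 0 s * X i) = leading_elt 0 s i + 1 \<odot> y"
    by (simp add: ht_def leading_elt_def r_def basis_elt_0)
  moreover have "y \<in> low (\<lambda>j. ht 0 s j + ht 1 i j)"
    unfolding y_def
  proof (intro low_sum low_cong_scale)
    fix t assume "t \<in> {..<r}"
    show "basis_elt 1 (i + int r - 2 * int t) \<in> low (ht 1 (i + int r - 2 * int t))"
      by (rule low_basis_elt) simp
    show "ht 1 (i + int r - 2 * int t) j \<le> ht 0 s j + ht 1 i j" for j
      using \<open>t \<in> {..<r}\<close> unfolding ht_1 by (simp add: ht_def r_def)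
  qed simp
  ultimately show ?thesis
    unfolding good_def by blast
qed

text \<open>The factor \<open>S r\<close> shifts the sum of the indices by \<open>r\<close>: only the first summand of \<open>X_mult_S\<close> is not divisible by \<open>v\<close>.\<close>

lemma basis_elt_mult_S:
  assumes IH: "\<And>a b l. ht a b l \<le> (int n - 1) * int r \<Longrightarrow> good a b l" and "n > 0"
  obtains y where "y \<in> low (\<lambda>j. ht n s j + int r)"
    "(int n * int r) \<odot> (basis_elt n s * S r) = basis_elt n (s + int r) + 1 \<odot> y"
proof -
  obtain k where n: "n = Suc k" using \<open>n > 0\<close> gr0_implies_Suc by blast
  obtain m q where q: "q \<le> k" and s: "s = m * (int k + 1) + int q"
    by (rule decompose)
  define s' where "s' = m * int k + int q"
  define f where "f t = (int k * int r - int q + 2 * int t) \<odot> (basis_elt k s' * X (m + int r - 2 * int t))" for t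
  have ht: "ht k s' (m + int r - 2 * int t) = \<bar>int q - (int k * int r - 2 * (int k * int t) + int k)\<bar> - int k" for t
    by (simp add: ht_def s'_def algebra_simps)
  \<comment> \<open>The first bound makes the hypothesis \<open>IH\<close> applicable. By the
    second, the exponent in \<open>f t\<close> exceeds the one required by \<open>good\<close> when
    \<open>t > 0\<close>; at \<open>t = 0\<close> the two agree, so only there a leading element
    survives.\<close>
  have bounds: "ht k s' (m + int r - 2 * int t) \<le> int k * int r" 
    "t > 0 \<Longrightarrow> ht k s' (m + int r - 2 * int t) \<le> int k * int r - int q + 2 * int t - 1" if "t \<le> r" for t
  proof -
    have "0 \<le> int k * int t" "int k * int t \<le> int k * int r"
      using that by (simp_all add: mult_left_mono)
    then show "ht k s' (m + int r - 2 * int t) \<le> int k * int r" 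
      "t > 0 \<Longrightarrow> ht k s' (m + int r - 2 * int t) \<le> int k * int r - int q + 2 * int t - 1"
      unfolding ht using q by linarith+
  qed
  have good: "good k s' (m + int r - 2 * int t)" if "t \<le> r" for t
    by (rule IH) (use bounds(1)[OF that] in \<open>simp add: n\<close>)
  have htS: "ht n s j = ht k s' j + ht 1 m j" for j
    unfolding n s s'_def by (rule ht_Suc) (rule q)
  have H: "ht k s' j + ht 1 (m + int r - 2 * int t) j \<le> ht n s j + int r" if "t \<le> r" for t j
    using that unfolding htS ht_1 by linarith
  have "(int n * int r) \<odot> (basis_elt n s * S r) = (\<Sum>t\<le>r. f t)"
    unfolding n s basis_elt_Suc[OF q] scale_mult_left mult.assoc X_mult_S sum_distrib_left scale_sum f_def
    by (intro sum.cong refl) (simp add: s'_def algebra_simps)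
  also have "{..r} = insert 0 {0<..r}" by auto
  also have "(\<Sum>t\<in>\<dots>. f t) = f 0 + (\<Sum>t\<in>{0<..r}. f t)" by simp
  finally have sum: "(int n * int r) \<odot> (basis_elt n s * S r) = f 0 + (\<Sum>t\<in>{0<..r}. f t)" .
  obtain y where y: "y \<in> low (\<lambda>j. ht k s' j + ht 1 (m + int r - 2 * int 0) j)"
    "\<And>c. c \<odot> (basis_elt k s' * X (m + int r - 2 * int 0)) =
       (c - ht k s' (m + int r - 2 * int 0)) \<odot> (leading_elt k s' (m + int r - 2 * int 0) + 1 \<odot> y)"
    using goodE[OF good[of 0]] by blast
  have le: "0 \<le> int k * int r" by simp
  then have "\<bar>int q - (int k * int r + int k)\<bar> - int k = int k * int r - int q"
    using q by linarith
  then have ht0: "ht k s' (m + int r - 2 * int 0) = int k * int r - int q"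
    unfolding ht by simp
  have lead: "leading_elt k s' (m + int r - 2 * int 0) = basis_elt n (s + int r)"
  proof (cases "k = 0")
    case True
    with q show ?thesis by (simp add: leading_elt_def n s s'_def)
  next
    case False
    have "int q \<le> int k + int k * int r"
      using le q by linarith
    then have "\<not> int k * (m + int r - 2 * int 0 + 1) < s'"
      by (simp add: s'_def algebra_simps)
    with False show ?thesis by (simp add: leading_elt_def n s s'_def algebra_simps)
  qed
  have "f 0 = basis_elt n (s + int r) + 1 \<odot> y"
    using y(2)[of "int k * int r - int q"] unfolding ht0 lead by (simp add: f_def)
  moreover have "\<exists>y\<in>low (\<lambda>j. ht n s j + int r). f t = 1 \<odot> y" if "t \<in> {0<..r}" for t
  proof
    show "(-1) \<odot> f t \<in> low (\<lambda>j. ht n s j + int r)"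
      unfolding f_def scale_scale
      by (rule good_low[OF good]) (use that bounds H in auto)
  qed simp
  then obtain y' where y': "\<And>t. t \<in> {0<..r} \<Longrightarrow> y' t \<in> low (\<lambda>j. ht n s j + int r)"
    "\<And>t. t \<in> {0<..r} \<Longrightarrow> f t = 1 \<odot> y' t"
    by metis
  ultimately have "(int n * int r) \<odot> (basis_elt n s * S r) = basis_elt n (s + int r) + 1 \<odot> (y + sum y' {0<..r})"
    unfolding sum by (simp add: scale_add scale_sum)
  moreover have "y + sum y' {0<..r} \<in> low (\<lambda>j. ht n s j + int r)"
    using y(1) H[of 0] y'(1) by (intro low_add low_sum) (auto intro: low_mono[THEN subsetD, rotated])
  ultimately show thesis using that by blast
qed

text \<open>Either X i belongs to the cluster of the monomial, or the monomial is built from X (i +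
  1) and X (i + 2). Then one exchange X (i + 2) X i = v^2 X (i + 1)^2 + 1 suffices, and its constant
  term yields the leading element.\<close>

lemma good_near:
  assumes "n > 0" "int n * (i - 1) \<le> s" "s \<le> int n * (i + 2)"
  shows "good n s i"
proof -
  consider "int n * (i + 1) < s" | "int n * i \<le> s" "s \<le> int n * (i + 1)" | "s \<le> int n * i"
    by linarith
  then show ?thesis
  proof cases
    case 1
    \<comment> \<open>One less than the number of factors X (i + 2): one of them is consumed by the
      exchange.\<close>
    define q where "q = nat (s - int n * (i + 1) - 1)"
    define p where "p = nat (int n * (i + 2) - s)"
    have n: "n = p + Suc q"
      using 1 assms(3) by (simp add: p_def q_def algebra_simps)
    have s: "s = (i + 1) * int (p + Suc q) + int (Suc q)"
      using 1 assms(3) unfolding n[symmetric] by (simp add: q_def algebra_simps)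
    have eq1: "i + 1 + 1 = i + 2" "i + 1 - 1 = i" by simp_all
    have "ht n s i = - int p"
      by (simp add: n s ht_def algebra_simps)
    moreover have "basis_elt n s = (- int p * int (Suc q)) \<odot> (X (i + 2) ^ Suc q * X (i + 1) ^ p)"
      unfolding n s basis_elt_monomial cluster_monomial_eq' eq1 ..
    ultimately have "ht n s i \<odot> (basis_elt n s * X i) =
        (- int p - int p * int (Suc q)) \<odot> (X (i + 2) ^ q * X (i + 2) * (X (i + 1) ^ p * X i))"
      by (simp add: mult.assoc power_Suc2 del: power_Suc)
    also have "X (i + 1) ^ p * X i = (2 * int p) \<odot> (X i * X (i + 1) ^ p)"
      using power_commutation[of i p 1] by simp
    also have "X (i + 2) ^ q * X (i + 2) * ((2 * int p) \<odot> (X i * X (i + 1) ^ p)) =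
        (2 * int p) \<odot> (X (i + 2) ^ q * (X (i + 2) * X i) * X (i + 1) ^ p)"
      by (simp add: mult.assoc)
    also have "X (i + 2) * X i = 2 \<odot> X (i + 1) ^ 2 + 1"
      using exchange[of "i + 1"] by (simp add: eq1)
    also have "(- int p - int p * int (Suc q)) \<odot> (2 * int p) \<odot>
          (X (i + 2) ^ q * (2 \<odot> X (i + 1) ^ 2 + 1) * X (i + 1) ^ p) =
        (- int p * int q) \<odot> (X (i + 2) ^ q * X (i + 1) ^ p) +
        (2 - int p * int q) \<odot> (X (i + 2) ^ q * X (i + 1) ^ (p + 2))"
      by (simp add: distrib_left distrib_right scale_add mult.assoc power_add[symmetric] algebra_simps)
    also have "(- int p * int q) \<odot> (X (i + 2) ^ q * X (i + 1) ^ p) = basis_elt (n - 1) (s - i - 2)"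
    proof -
      have "basis_elt (n - 1) (s - i - 2) = cluster_monomial v X (i + 1) p q"
        by (rule basis_elt_monomial_eq) (simp_all add: n s algebra_simps)
      then show ?thesis by (simp add: cluster_monomial_eq' eq1)
    qed
    also have "basis_elt (n - 1) (s - i - 2) = leading_elt n s i"
      using 1 n by (simp add: leading_elt_def)
    also have "(2 - int p * int q) \<odot> (X (i + 2) ^ q * X (i + 1) ^ (p + 2)) =
        1 \<odot> (2 * int q + 1) \<odot> basis_elt (n + 1) (s + i)"
    proof -
      have "basis_elt (n + 1) (s + i) = cluster_monomial v X (i + 1) (p + 2) q"
        by (rule basis_elt_monomial_eq) (simp_all add: n s algebra_simps)
      then show ?thesis by (simp add: cluster_monomial_eq' eq1 algebra_simps)
    qed
    finally show ?thesis
      unfolding good_def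
    proof (rule bexI)
      show "(2 * int q + 1) \<odot> basis_elt (n + 1) (s + i) \<in> low (\<lambda>j. ht n s j + ht 1 i j)"
      proof (intro low_scale low_basis_elt)
        show "ht (n + 1) (s + i) j \<le> ht n s j + ht 1 i j" for j
          unfolding ht_1 by (simp add: ht_def algebra_simps)
      qed simp
    qed
  next
    case 2
    define q where "q = nat (s - int n * i)"
    define p where "p = nat (int n * (i + 1) - s)"
    have n: "n = p + q"
      using 2 by (simp add: p_def q_def algebra_simps)
    have s: "s = i * int (p + q) + int q"
      using 2 unfolding n[symmetric] by (simp add: q_def algebra_simps)
    have "basis_elt (n + 1) (s + i) = cluster_monomial v X i (p + 1) q"
      by (rule basis_elt_monomial_eq) (simp_all add: n s algebra_simps)
    moreover have "basis_elt n s = cluster_monomial v X i p q"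
      unfolding n s basis_elt_monomial ..
    moreover have "ht n s i = - int q"
      by (simp add: n s ht_def algebra_simps)
    ultimately have "ht n s i \<odot> (basis_elt n s * X i) = leading_elt n s i + 1 \<odot> 0"
      using 2 \<open>n > 0\<close>
      by (simp add: leading_elt_def cluster_monomial_eq' mult.assoc power_Suc2 algebra_simps del: power_Suc)
    then show ?thesis
      unfolding good_def by (rule bexI) (simp add: low_def lattice.zero)
  next
    case 3
    define q where "q = nat (s - int n * (i - 1))"
    define p where "p = nat (int n * i - s)"
    have n: "n = p + q"
      using 3 assms(2) by (simp add: p_def q_def algebra_simps)
    have s: "s = (i - 1) * int (p + q) + int q"
      using 3 assms(2) unfolding n[symmetric] by (simp add: q_def algebra_simps)
    have "basis_elt (n + 1) (s + i) = cluster_monomial v X (i - 1) p (q + 1)"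
      by (rule basis_elt_monomial_eq) (simp_all add: n s algebra_simps)
    moreover have "basis_elt n s = cluster_monomial v X (i - 1) p q"
      unfolding n s basis_elt_monomial ..
    moreover have "ht n s i = int p"
      by (simp add: n s ht_def algebra_simps)
    ultimately have "ht n s i \<odot> (basis_elt n s * X i) = leading_elt n s i + 1 \<odot> 0"
      using 3 \<open>n > 0\<close>
      by (simp add: leading_elt_def cluster_monomial_eq mult.assoc power_Suc2 algebra_simps del: power_Suc)
    then show ?thesis
      unfolding good_def by (rule bexI) (simp add: low_def lattice.zero)
  qed
qed

text \<open>
  Away from the cases of \<open>good_near\<close>, split off the factor \<open>X m\<close> of \<open>basis_elt n s\<close> with the smallest
  index and rewrite \<open>X m * X i\<close> by \<open>X_mult_far\<close> (for \<open>m > i\<close>, where the Chebyshev term is the leading one)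
  or \<open>X_mult_far'\<close> (for \<open>m < i\<close>, where the product of cluster variables is).
\<close>

lemma good: "good n s i"
\<comment> \<open>The measure is the exponent of v. Its negative values, which \<open>nat\<close>
  collapses, occur only in the cases settled without the induction hypothesis.\<close>
proof (induction "nat (ht n s i)" arbitrary: n s i rule: less_induct)
  case less
  consider "n = 0" | "n > 0" "int n * (i - 1) \<le> s" "s \<le> int n * (i + 2)"
    | "n > 0" "int n * (i + 2) < s" | "n > 0" "s < int n * (i - 1)"
    by linarith
  then show ?case
  proof cases
    case 1
    then show ?thesis by (simp add: good_0)
  next
    case 2
    then show ?thesis by (rule good_near)
  next
    case 3
    then obtain k where n: "n = Suc k" using gr0_implies_Suc by blast
    obtain m q where q: "q \<le> k" and s: "s = m * (int k + 1) + int q"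
      by (rule decompose)
    define s' where "s' = m * int k + int q"
    define h where "h = ht n s i"
    have pos: "(int k + 1) * (m - i - 2) + int q > 0"
      using 3(2) by (simp add: n s algebra_simps)
    have "m \<ge> i + 2"
    proof (rule ccontr)
      assume "\<not> ?thesis"
      then have "(int k + 1) * (m - i - 2) \<le> (int k + 1) * (- 1)"
        by (intro mult_left_mono) auto
      with pos q show False by simp
    qed
    \<comment> \<open>The distance that remains after X m and X i have moved one step towards each
      other.\<close>
    define d where "d = nat (m - i - 2)"
    have m: "m = i + 2 + int d" using \<open>m \<ge> i + 2\<close> by (simp add: d_def)
    have h: "h = int k * int d + int d + int q"
    proof -
      have "int k * int d \<ge> 0" by simp
      moreover have "h = \<bar>int k * int d + int k + int d + 1 + int q\<bar> - (int k + 1)"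
        by (simp add: h_def n s ht_def m algebra_simps)
      ultimately show ?thesis by linarith
    qed
    have h_pos: "h > 0"
      using pos unfolding h by (simp add: m algebra_simps)
    have IH: "good a b l" if "ht a b l < h" for a b l
      by (rule less) (use that h_pos in \<open>simp add: h_def\<close>)
    have htS: "ht n s j = ht k s' j + ht 1 m j" for j
      unfolding n s s'_def by (rule ht_Suc) (rule q)
    have kd: "int k * int d \<ge> 0" by simp

    have XX: "X m * X i = 2 \<odot> (X (m - 1) * X (i + 1)) + (- int d) \<odot> S d"
      using X_mult_far[of "i + 1" d] by (simp add: m algebra_simps)
    have prod: "h \<odot> (basis_elt n s * X i) =
        (h - int q + 2) \<odot> (basis_elt k s' * X (m - 1) * X (i + 1)) + (int k * int d) \<odot> (basis_elt k s' * S d)"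
      unfolding n s basis_elt_Suc[OF q] s'_def[symmetric]
      by (simp add: mult.assoc XX distrib_left scale_add h algebra_simps)

    \<comment> \<open>Of the exponent h, q is spent on splitting off X m and d on
      \<open>X_mult_far\<close>. What remains is k d, exactly the power normalised by
      \<open>basis_elt_mult_S\<close>, so the Chebyshev summand carries the leading element.\<close>
    obtain y where y: "y \<in> low (\<lambda>j. ht n s j + ht 1 i j)"
      "(int k * int d) \<odot> (basis_elt k s' * S d) = leading_elt n s i + 1 \<odot> y"
    proof (cases "k = 0")
      case True
      have "basis_elt k s' * S d = leading_elt n s i"
        using True q 3 by (simp add: leading_elt_def basis_elt_0 n s s'_def m)
      with True that[of 0] show thesis by (simp add: low_def lattice.zero)
    next
      case False
      have IH': "good a b l" if "ht a b l \<le> (int k - 1) * int d" for a b l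
        by (rule IH) (use that h_pos kd in \<open>cases "d = 0"; simp add: h algebra_simps\<close>)
      obtain y where y: "y \<in> low (\<lambda>j. ht k s' j + int d)"
        "(int k * int d) \<odot> (basis_elt k s' * S d) = basis_elt k (s' + int d) + 1 \<odot> y"
        using basis_elt_mult_S[OF IH'] False by blast
      have "basis_elt k (s' + int d) = leading_elt n s i"
        using 3 False mult_nonneg_nonneg[of "int n" "1"]
        by (simp add: leading_elt_def n s s'_def m algebra_simps)
      moreover have "low (\<lambda>j. ht k s' j + int d) \<subseteq> low (\<lambda>j. ht n s j + ht 1 i j)"
        by (rule low_mono) (unfold htS ht_1, simp add: m)
      ultimately show thesis using y that by auto
    qed

    define H1 where "H1 j = ht k s' j + ht 1 (m - 1) j" for j
    have e1: "ht k s' (m - 1) = int q - int k"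
      by (simp add: ht_def s'_def algebra_simps)
    have low0: "(int q - int k) \<odot> (basis_elt k s' * X (m - 1)) \<in> low H1"
      by (rule good_low[OF IH]) (use q h_pos in \<open>auto simp: e1 H1_def\<close>)
    \<comment> \<open>The first inequality admits the induction hypothesis for the multiplication by
      X (i + 1); the second leaves one factor v over, so this summand is subordinate.\<close>
    have H1_less: "H1 (i + 1) < h" "H1 (i + 1) + (int q - int k) + 1 \<le> h - int q + 2"
    proof -
      have "H1 (i + 1) = \<bar>int k * int d + int q\<bar> - int k + \<bar>int d - 1\<bar> - 1"
        unfolding H1_def ht_1 by (simp add: ht_def s'_def m algebra_simps)
      then show "H1 (i + 1) < h" "H1 (i + 1) + (int q - int k) + 1 \<le> h - int q + 2"
        using q kd h_pos unfolding h by (cases "d = 0"; simp)+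
    qed
    have "(h - int q + 2 - 1 - (int q - int k)) \<odot>
        ((int q - int k) \<odot> (basis_elt k s' * X (m - 1)) * X (i + 1)) \<in> low (\<lambda>j. ht n s j + ht 1 i j)"
      using low0
    proof (rule low_mult_X)
      show "good a b (i + 1)" if "\<And>j. ht a b j \<le> H1 j" for a b
        by (rule IH) (use that[of "i + 1"] H1_less in linarith)
      show "H1 j + ht 1 (i + 1) j \<le> ht n s j + ht 1 i j" for j
        unfolding H1_def htS ht_1 by (simp add: m)
    qed (use H1_less in auto)
    then have "(h - int q + 1) \<odot> (basis_elt k s' * X (m - 1) * X (i + 1)) \<in> low (\<lambda>j. ht n s j + ht 1 i j)"
      by (simp add: algebra_simps)
    with y(1) have "(h - int q + 1) \<odot> (basis_elt k s' * X (m - 1) * X (i + 1)) + y \<in> low (\<lambda>j. ht n s j + ht 1 i j)"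
      by (rule low_add[rotated])
    moreover have "ht n s i \<odot> (basis_elt n s * X i) = leading_elt n s i +
        1 \<odot> ((h - int q + 1) \<odot> (basis_elt k s' * X (m - 1) * X (i + 1)) + y)"
      unfolding h_def[symmetric] prod y(2) by (simp add: scale_add algebra_simps)
    ultimately show ?thesis
      unfolding good_def by blast
  next
    case 4
    then obtain k where n: "n = Suc k" using gr0_implies_Suc by blast
    obtain m q where q: "q \<le> k" and s: "s = m * (int k + 1) + int q"
      by (rule decompose)
    define s' where "s' = m * int k + int q"
    define h where "h = ht n s i"
    have neg: "(int k + 1) * (m - i + 1) + int q < 0"
      using 4(2) by (simp add: n s algebra_simps)
    have "m \<le> i - 2"
    proof (rule ccontr)
      assume "\<not> ?thesis"
      then have "(int k + 1) * (m - i + 1) \<ge> (int k + 1) * 0"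
        by (intro mult_left_mono) auto
      with neg show False by simp
    qed
    define d where "d = nat (i - m - 2)"
    have i: "i = m + 2 + int d" using \<open>m \<le> i - 2\<close> by (simp add: d_def)
    have kd: "int k * int d \<ge> 0" by simp
    have h: "h = int k * int d + int d + 2 * int k + 2 - int q"
    proof -
      have "h = \<bar>int q - (int k * int d + 3 * int k + int d + 3)\<bar> - (int k + 1)"
        by (simp add: h_def n s ht_def i algebra_simps)
      moreover have "int q - (int k * int d + 3 * int k + int d + 3) \<le> 0"
        using q kd by linarith
      ultimately show ?thesis by simp
    qed
    have h_pos: "h > 0"
      using q kd h by linarith
    have IH: "good a b l" if "ht a b l < h" for a b l
      by (rule less) (use that h_pos in \<open>simp add: h_def\<close>)
    have htS: "ht n s j = ht k s' j + ht 1 m j" for j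
      unfolding n s s'_def by (rule ht_Suc) (rule q)

    have XX: "X m * X i = (-2) \<odot> (X (m + 1) * X (i - 1)) + int d \<odot> S d"
      using X_mult_far'[of "m + 1" d] by (simp add: i algebra_simps)
    have prod: "h \<odot> (basis_elt n s * X i) =
        (h - int q - 2) \<odot> (basis_elt k s' * X (m + 1) * X (i - 1)) + (h - int q + int d) \<odot> (basis_elt k s' * S d)"
      unfolding n s basis_elt_Suc[OF q] s'_def[symmetric]
      by (simp add: mult.assoc XX distrib_left scale_add h algebra_simps)

    \<comment> \<open>In this direction the Chebyshev summand is subordinate: its exponent exceeds k
      d, and one factor v is taken out.\<close>
    define y where "y = (h - int q + int d - 1) \<odot> (basis_elt k s' * S d)"
    have y: "y \<in> low (\<lambda>j. ht n s j + ht 1 i j)" "(h - int q + int d) \<odot> (basis_elt k s' * S d) = 1 \<odot> y"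
    proof -
      have "(h - int q + int d - 1) \<odot> (basis_elt k s' * S d) \<in> low (\<lambda>j. ht n s j + ht 1 i j)"
    proof (cases "k = 0")
      case True
      have "basis_elt k s' * S d = basis_elt 0 (int d)"
        using True q by (simp add: basis_elt_0 s'_def)
      moreover have "basis_elt 0 (int d) \<in> low (\<lambda>j. ht n s j + ht 1 i j)"
      proof (rule low_basis_elt)
        show "ht 0 (int d) j \<le> ht n s j + ht 1 i j" for j
          using True q unfolding htS ht_1 by (simp add: ht_def i s'_def)
      qed
      ultimately show ?thesis using q True by (simp add: low_scale h)
    next
      case False
      have IH': "good a b l" if "ht a b l \<le> (int k - 1) * int d" for a b l
        by (rule IH) (use that q kd in \<open>simp add: h algebra_simps\<close>)
      obtain y where y: "y \<in> low (\<lambda>j. ht k s' j + int d)"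
        "(int k * int d) \<odot> (basis_elt k s' * S d) = basis_elt k (s' + int d) + 1 \<odot> y"
        using basis_elt_mult_S[OF IH'] False by blast
      have "basis_elt k (s' + int d) \<in> low (\<lambda>j. ht k s' j + int d)"
        by (rule low_basis_elt) (simp add: ht_def)
      then have "(int k * int d) \<odot> (basis_elt k s' * S d) \<in> low (\<lambda>j. ht k s' j + int d)"
        unfolding y(2) by (intro low_add low_scale y(1)) auto
      then have "(h - int q + int d - 1 - int k * int d) \<odot> (int k * int d) \<odot> (basis_elt k s' * S d)
          \<in> low (\<lambda>j. ht n s j + ht 1 i j)"
      proof (rule low_cong_scale)
        show "ht k s' j + int d \<le> ht n s j + ht 1 i j" for j
          unfolding htS ht_1 by (simp add: i)
      qed (use q in \<open>simp add: h\<close>)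
      then show ?thesis by simp
    qed
    then show "y \<in> low (\<lambda>j. ht n s j + ht 1 i j)" "(h - int q + int d) \<odot> (basis_elt k s' * S d) = 1 \<odot> y"
      by (simp_all add: y_def algebra_simps)
    qed

    define H1 where "H1 j = ht k s' j + ht 1 (m + 1) j" for j
    have e1: "ht k s' (m + 1) = int k - int q"
      using q by (simp add: ht_def s'_def algebra_simps)
    have "good k s' (m + 1)"
      by (rule IH, unfold e1 h) (use q kd in linarith)
    moreover have "leading_elt k s' (m + 1) = basis_elt n (s + 1)"
      using q by (cases "k = 0") (simp_all add: leading_elt_def n s s'_def algebra_simps)
    ultimately obtain y1 where y1: "y1 \<in> low H1"
      "(int k - int q) \<odot> (basis_elt k s' * X (m + 1)) = basis_elt n (s + 1) + 1 \<odot> y1"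
      unfolding good_def e1 H1_def[symmetric] by auto

    \<comment> \<open>The leading element has to survive two multiplications, by X (m + 1) and then
      by X (i - 1). The first uses k - q of the available exponent h - q - 2. The rest, e2, is
      precisely \<open>ht n (s + 1) (i - 1)\<close>, so the coefficient 1 is preserved.\<close>
    define e2 where "e2 = h - int k - 2"
    have e2: "ht n (s + 1) (i - 1) = e2"
    proof -
      have "ht n (s + 1) (i - 1) = \<bar>int q + 1 - (int k * int d + 2 * int k + int d + 2)\<bar> - (int k + 1)"
        by (simp add: ht_def n s i algebra_simps)
      with q kd show ?thesis unfolding e2_def h by linarith
    qed
    have H1: "H1 (i - 1) = e2"
    proof -
      have "H1 (i - 1) = \<bar>int q - (int k * int d + 2 * int k)\<bar> - int k + int d"
        unfolding H1_def ht_1 by (simp add: ht_def s'_def i algebra_simps)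
      with q kd show ?thesis unfolding e2_def h by linarith
    qed
    have e2_less: "e2 < h" by (simp add: e2_def)
    have "\<not> int n * (i - 1 + 1) < s + 1"
      using neg q mult_nonneg_nonneg[of "int k" "int d"] by (simp add: n s i algebra_simps)
    then have "leading_elt n (s + 1) (i - 1) = leading_elt n s i"
      using 4 by (simp add: leading_elt_def algebra_simps n)
    then obtain y2 where y2: "y2 \<in> low (\<lambda>j. ht n (s + 1) j + ht 1 (i - 1) j)"
      "e2 \<odot> (basis_elt n (s + 1) * X (i - 1)) = leading_elt n s i + 1 \<odot> y2"
      using IH[of n "s + 1" "i - 1"] e2_less unfolding good_def e2 by auto

    have tri: "H1 j + ht 1 (i - 1) j \<le> ht n s j + ht 1 i j" for j
      unfolding H1_def htS ht_1 by (simp add: i)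
    have "ht n (s + 1) j \<le> H1 j" for j
      unfolding H1_def ht_1 by (simp add: ht_def n s s'_def algebra_simps)
    then have "low (\<lambda>j. ht n (s + 1) j + ht 1 (i - 1) j) \<subseteq> low (\<lambda>j. ht n s j + ht 1 i j)"
      by (intro low_mono) (use tri add_right_mono order_trans in blast)
    with y2(1) have y2': "y2 \<in> low (\<lambda>j. ht n s j + ht 1 i j)"
      by blast
    have y1': "e2 \<odot> (y1 * X (i - 1)) \<in> low (\<lambda>j. ht n s j + ht 1 i j)"
      using y1(1)
    proof (rule low_mult_X)
      show "good a b (i - 1)" if "\<And>j. ht a b j \<le> H1 j" for a b
        by (rule IH) (use that[of "i - 1"] H1 e2_less in linarith)
    qed (use H1 tri in auto)

    have "(h - int q - 2) \<odot> (basis_elt k s' * X (m + 1) * X (i - 1)) =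
        e2 \<odot> (((int k - int q) \<odot> (basis_elt k s' * X (m + 1))) * X (i - 1))"
      by (simp add: e2_def algebra_simps)
    also have "\<dots> = leading_elt n s i + 1 \<odot> (y2 + e2 \<odot> (y1 * X (i - 1)))"
      unfolding y1(2)
      by (simp only: distrib_right scale_add scale_mult_left scale_scale y2(2) add.assoc add.commute[of e2])
    finally have "ht n s i \<odot> (basis_elt n s * X i) =
        leading_elt n s i + 1 \<odot> (y2 + e2 \<odot> (y1 * X (i - 1)) + y)"
      unfolding h_def[symmetric] prod y(2) by (simp add: scale_add algebra_simps)
    moreover have "y2 + e2 \<odot> (y1 * X (i - 1)) + y \<in> low (\<lambda>j. ht n s j + ht 1 i j)"
      by (intro low_add y2' y1' y(1))
    ultimately show ?thesis
      unfolding good_def by blast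
  qed
qed

end

section \<open>The cluster variables\<close>

locale quantum_cluster_A11 =
  fixes v :: "'a::division_ring" and X :: "int \<Rightarrow> 'a"
  assumes cluster_variables: "cluster_variables_A11 v X"

sublocale quantum_cluster_A11 \<subseteq> central_unit v
  by unfold_locales
     (use cluster_variables in \<open>auto simp: cluster_variables_A11_def skew_field_of_fractions_of_quantum_torus_def\<close>)

context quantum_cluster_A11
begin

lemma initial_seed:
  "X 1 \<noteq> 0" "X 2 \<noteq> 0" "X 2 * X 1 = 2 \<odot> (X 1 * X 2)"
  using cluster_variables
  by (auto simp: cluster_variables_A11_def skew_field_of_fractions_of_quantum_torus_def v_eq_scale mult.assoc)

lemma exchange: "X (m + 1) * X (m - 1) = 2 \<odot> X m ^ 2 + 1"
  using cluster_variables by (auto simp: cluster_variables_A11_def v_eq_scale)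

lemma torus_basis:
  "inj (\<lambda>(a, b). X 1 powi a * X 2 powi b)"
  "\<not> L.dependent (range (\<lambda>(a, b). X 1 powi a * X 2 powi b))"
  using cluster_variables
  by (auto simp: cluster_variables_A11_def skew_field_of_fractions_of_quantum_torus_def laurent_basis_def)

text \<open>Otherwise v^4 - 1 would be a nontrivial relation for the single torus monomial
  1.\<close>

lemma scale_4_neq: "4 \<odot> x \<noteq> x" if "x \<noteq> 0"
proof
  assume "4 \<odot> x = x"
  then have "v powi 4 * x = 1 * x"
    by (simp add: scale_def)
  then have "v powi 4 = 1"
    by (simp only: mult_right_cancel[OF that])
  then have "eval_laurent v (Poly_Mapping.single 4 1 - Poly_Mapping.single 0 1) = 0"
    by (simp add: eval_laurent_diff eval_laurent_single del: single_one)
  then have "lscale v (Poly_Mapping.single 4 1 - Poly_Mapping.single 0 1) ((\<lambda>(a, b). X 1 powi a * X 2 powi b) (0, 0)) = 0"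
    by (simp add: lscale_def del: single_one)
  then have "Poly_Mapping.single (4 :: int) (1 :: int) - Poly_Mapping.single 0 1 = 0"
    using independent_familyD[OF independent_familyI[OF torus_basis], of "{(0, 0)}" "\<lambda>_. Poly_Mapping.single 4 1 - Poly_Mapping.single 0 1"]
    by simp
  then have "Poly_Mapping.lookup (Poly_Mapping.single (4 :: int) (1 :: int)) 4 = Poly_Mapping.lookup (Poly_Mapping.single (0 :: int) (1 :: int)) 4"
    by (simp only: eq_iff_diff_eq_0[symmetric])
  then show False
    by (simp add: lookup_single del: single_one)
qed

text \<open>Otherwise \<open>x\<^sup>2\<close> would be central, but it commutes with \<open>y\<close> only up to \<open>v\<^sup>4\<close> and \<open>v\<close> is not a root of unity.\<close>

lemma exchange_nonzero:
  assumes "x \<noteq> 0" "y \<noteq> 0" "x ^ 2 * y = k \<odot> (y * x ^ 2)" "k = 4 \<or> k = -4"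
  shows "2 \<odot> x ^ 2 + 1 \<noteq> 0"
proof
  assume "2 \<odot> x ^ 2 + 1 = 0"
  then have "2 \<odot> x ^ 2 = - 1"
    by (simp add: add_eq_0_iff2)
  then have "x ^ 2 = (- 2) \<odot> (- 1)"
    by (rule scale_eq_iff[THEN iffD1])
  with assms(3) have "(- 2) \<odot> y = (- 2) \<odot> k \<odot> y"
    by (simp add: add.commute)
  then have "y = k \<odot> y"
    by (simp only: scale_cancel)
  then have "4 \<odot> y = y"
    using assms(4) scale_eq_iff[of "-4" y y] by auto
  with scale_4_neq[OF assms(2)] show False by simp
qed

text \<open>The claims depend on each other: the next variable is a quotient by a cluster variable,
  so its commutation needs nonvanishing, while its nonvanishing comes from
  \<open>exchange_nonzero\<close>, which needs commutation.\<close>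

lemma nonzero_commutation:
  "X m \<noteq> 0 \<and> X (m + 1) \<noteq> 0 \<and> X (m + 1) * X m = 2 \<odot> (X m * X (m + 1))"
proof (induction m rule: int_induct[where k = 1])
  case base
  then show ?case using initial_seed by simp
next
  case (step1 m)
  then have nz: "X m \<noteq> 0" "X (m + 1) \<noteq> 0" and comm: "X (m + 1) * X m = 2 \<odot> (X m * X (m + 1))"
    by auto
  have "X (m + 1) ^ 2 * X m = 4 \<odot> (X m * X (m + 1) ^ 2)"
    using power_int_commute_scale[OF comm nz, of 2 1] by simp
  then have "2 \<odot> X (m + 1) ^ 2 + 1 \<noteq> 0"
    using nz exchange_nonzero by blast
  then have "X (m + 1 + 1) \<noteq> 0"
    using exchange[of "m + 1"] by auto
  moreover have "X (m + 1 + 1) = (2 \<odot> X (m + 1) ^ 2 + 1) * inverse (X m)"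
  proof -
    have "X (m + 1 + 1) * (X m * inverse (X m)) = (2 \<odot> X (m + 1) ^ 2 + 1) * inverse (X m)"
      using exchange[of "m + 1"] by (simp only: mult.assoc[symmetric] add_diff_cancel_right')
    then show ?thesis using nz by simp
  qed
  moreover have "inverse (X m) * X (m + 1) = 2 \<odot> (X (m + 1) * inverse (X m))"
    using power_int_commute_scale[OF comm nz, of 1 "-1"] by simp
  ultimately show ?case
    using nz by (simp add: mult.assoc distrib_left distrib_right power2_eq_square scale_add)
next
  case (step2 m)
  then have nz: "X m \<noteq> 0" "X (m + 1) \<noteq> 0" and comm: "X (m + 1) * X m = 2 \<odot> (X m * X (m + 1))"
    by auto
  have "X m ^ 2 * X (m + 1) = (-4) \<odot> (X (m + 1) * X m ^ 2)"
    using power_int_commute_scale[OF comm nz, of 1 2] by simp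
  then have "2 \<odot> X m ^ 2 + 1 \<noteq> 0"
    using nz exchange_nonzero by blast
  then have "X (m - 1) \<noteq> 0"
    using exchange[of m] by auto
  moreover have eq: "X (m - 1) = inverse (X (m + 1)) * (2 \<odot> X m ^ 2 + 1)"
  proof -
    have "(inverse (X (m + 1)) * X (m + 1)) * X (m - 1) = inverse (X (m + 1)) * (2 \<odot> X m ^ 2 + 1)"
      by (simp only: mult.assoc exchange)
    then show ?thesis using nz by simp
  qed
  moreover have "X m * inverse (X (m + 1)) = 2 \<odot> (inverse (X (m + 1)) * X m)"
    using power_int_commute_scale[OF comm nz, of "-1" 1] by simp
  then have "X m * X (m - 1) = 2 \<odot> (X (m - 1) * X m)"
    unfolding eq mult.assoc[symmetric]
    by (simp add: distrib_left distrib_right power2_eq_square scale_add) (simp add: mult.assoc)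
  ultimately show ?case
    using nz by simp
qed

lemma X_nonzero: "X m \<noteq> 0"
  and commutation: "X (m + 1) * X m = 2 \<odot> (X m * X (m + 1))"
  using nonzero_commutation by blast+

text \<open>Multiply by X (m - 1) on the right, apply \<open>exchange\<close>, move X (m - 1) past X
  m ^ 2 and cancel it.\<close>

lemma exchange': "X (m - 1) * X (m + 1) = (-2) \<odot> X m ^ 2 + 1"
proof -
  have "X m ^ 2 * X (m - 1) = 4 \<odot> (X (m - 1) * X m ^ 2)"
    using power_int_commute_scale[of "X m" "X (m - 1)" 2 2 1] commutation[of "m - 1"] X_nonzero by simp
  then have "X (m - 1) * X (m + 1) * X (m - 1) = ((-2) \<odot> X m ^ 2 + 1) * X (m - 1)"
    by (simp add: mult.assoc exchange distrib_left distrib_right)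
  then show ?thesis
    using X_nonzero by simp
qed

abbreviation z :: 'a where "z \<equiv> X_delta v X"

lemma z_eq: "z = 1 \<odot> (X 3 * X 0) - 3 \<odot> (X 2 * X 1)"
  by (simp add: X_delta_def v_eq_scale mult.assoc)

text \<open>The definition of \<open>z\<close> gives \<open>m = 1\<close>. Since neighbours commute
  up to a power of v, (z X (m + 1)) X m is a multiple of (z X m) X (m + 1), so the recursion passes
  from m to m + 1, and likewise downwards: \<open>z\<close> is a conserved quantity of the exchange
  recursion.\<close>

lemma z_left: "z * X m = 1 \<odot> X (m + 1) + (-1) \<odot> X (m - 1)"
proof (induction m rule: int_induct[where k = 1])
  case base
  have "X 0 * X 1 = (-2) \<odot> (X 1 * X 0)"
    using commutation[of 0] by simp
  then have "z * X 1 = (-1) \<odot> ((X 3 * X 1) * X 0) - 3 \<odot> (X 2 * X 1 ^ 2)"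
    by (simp add: z_eq left_diff_distrib mult.assoc power2_eq_square)
  also have "(X 3 * X 1) * X 0 = 2 \<odot> (X 2 * (X 2 * X 0)) + X 0"
    using exchange[of 2] by (simp add: distrib_right power2_eq_square mult.assoc)
  also have "X 2 * X 0 = 2 \<odot> X 1 ^ 2 + 1"
    using exchange[of 1] by simp
  finally show ?case
    by (simp add: distrib_left scale_add)
next
  case (step1 m)
  have "(z * X (m + 1)) * X m = 2 \<odot> ((z * X m) * X (m + 1))"
    by (simp add: mult.assoc commutation)
  also have "\<dots> = (1 \<odot> X (m + 1 + 1) + (-1) \<odot> X (m + 1 - 1)) * X m"
    using exchange[of "m + 1"] exchange'[of m]
    by (simp add: step1 distrib_right scale_add power2_eq_square)
  finally show ?case
    by (simp only: mult_right_cancel[OF X_nonzero])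
next
  case (step2 m)
  have "X (m - 1) * X m = (-2) \<odot> (X m * X (m - 1))"
    using commutation[of "m - 1"] by simp
  then have "(z * X (m - 1)) * X m = (-2) \<odot> ((z * X m) * X (m - 1))"
    by (simp add: mult.assoc)
  also have "\<dots> = (1 \<odot> X (m - 1 + 1) + (-1) \<odot> X (m - 1 - 1)) * X m"
    using exchange[of m] exchange'[of "m - 1"]
    by (simp add: step2 distrib_right scale_add power2_eq_square)
  finally show ?case
    by (simp only: mult_right_cancel[OF X_nonzero])
qed

lemma z_right: "X m * z = (-1) \<odot> X (m + 1) + 1 \<odot> X (m - 1)"
proof (induction m rule: int_induct[where k = 1])
  case base
  have "X 1 * X 2 = (-2) \<odot> (X 2 * X 1)"
    using commutation[of 1] by simp
  then have "X 1 * z = 1 \<odot> ((X 1 * X 3) * X 0) - 1 \<odot> (X 2 * X 1 ^ 2)"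
    by (simp add: z_eq right_diff_distrib power2_eq_square flip: mult.assoc)
  also have "(X 1 * X 3) * X 0 = (-2) \<odot> (X 2 * (X 2 * X 0)) + X 0"
    using exchange'[of 2] by (simp add: distrib_right power2_eq_square mult.assoc)
  also have "X 2 * X 0 = 2 \<odot> X 1 ^ 2 + 1"
    using exchange[of 1] by simp
  finally show ?case
    by (simp add: distrib_left scale_add)
next
  case (step1 m)
  have "X m * X (m + 1) = (-2) \<odot> (X (m + 1) * X m)"
    using commutation[of m] by simp
  then have "X m * (X (m + 1) * z) = (-2) \<odot> (X (m + 1) * (X m * z))"
    by (simp flip: mult.assoc)
  also have "\<dots> = X m * ((-1) \<odot> X (m + 1 + 1) + 1 \<odot> X (m + 1 - 1))"
    using exchange[of m] exchange'[of "m + 1"]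
    by (simp add: step1 distrib_left scale_add power2_eq_square)
  finally show ?case
    by (simp only: mult_left_cancel[OF X_nonzero])
next
  case (step2 m)
  have "X m * (X (m - 1) * z) = 2 \<odot> (X (m - 1) * (X m * z))"
    using commutation[of "m - 1"] by (simp flip: mult.assoc)
  also have "\<dots> = X m * ((-1) \<odot> X (m - 1 + 1) + 1 \<odot> X (m - 1 - 1))"
    using exchange[of "m - 1"] exchange'[of m]
    by (simp add: step2 distrib_left scale_add power2_eq_square)
  finally show ?case
    by (simp only: mult_left_cancel[OF X_nonzero])
qed

end

sublocale quantum_cluster_A11 \<subseteq> kronecker v X "X_delta v X"
  by unfold_locales (rule X_nonzero commutation exchange exchange' z_left z_right)+

section \<open>Lowest terms and the bar involution in the quantum torus\<close>

context quantum_cluster_A11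
begin

text \<open>The factor v^(ab) makes the monomials bar-invariant and their structure constants powers
  of v given by a skew form.\<close>

definition tmon :: "int \<times> int \<Rightarrow> 'a" where
  "tmon = (\<lambda>(a, b). (a * b) \<odot> (X 1 powi a * X 2 powi b))"

lemma tmon_mult: "tmon (a, b) * tmon (c, d) = (b * c - a * d) \<odot> tmon (a + c, b + d)"
proof -
  have "X 2 powi b * X 1 powi c = (2 * b * c) \<odot> (X 1 powi c * X 2 powi b)"
    by (rule power_int_commute_scale) (use initial_seed in auto)
  then have "X 1 powi a * (X 2 powi b * X 1 powi c) * X 2 powi d =
      (2 * b * c) \<odot> (X 1 powi a * X 1 powi c * (X 2 powi b * X 2 powi d))"
    by (simp add: mult.assoc)
  also have "\<dots> = (2 * b * c) \<odot> (X 1 powi (a + c) * X 2 powi (b + d))"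
    using initial_seed by (simp add: power_int_add)
  finally have "(a * b + c * d) \<odot> (X 1 powi a * (X 2 powi b * X 1 powi c) * X 2 powi d) =
      (a * b + c * d) \<odot> (2 * b * c) \<odot> (X 1 powi (a + c) * X 2 powi (b + d))"
    by (simp only:)
  then show ?thesis
    by (simp add: tmon_def mult.assoc algebra_simps)
qed

lemma tmon_0: "tmon (0, 0) = 1" and tmon_1: "tmon (1, 0) = X 1" and tmon_2: "tmon (0, 1) = X 2"
  by (simp_all add: tmon_def)

lemma tmon_independent: "independent_family tmon"
  unfolding independent_family_def
proof (intro allI impI ballI)
  fix I p i
  assume I: "finite I" "(\<Sum>i\<in>I. lscale v (p i) (tmon i)) = 0" "i \<in> I"
  define q where "q i = p i * Poly_Mapping.single (fst i * snd i) 1" for i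
  have "lscale v (p i) (tmon i) = lscale v (q i) ((\<lambda>(a, b). X 1 powi a * X 2 powi b) i)" for i
    by (cases i) (simp add: tmon_def q_def L.scale_scale[symmetric] lscale_single)
  with I(2) have "(\<Sum>i\<in>I. lscale v (q i) ((\<lambda>(a, b). X 1 powi a * X 2 powi b) i)) = 0"
    by simp
  from independent_familyD[OF independent_familyI[OF torus_basis] I(1) this I(3)]
  have "q i * Poly_Mapping.single (- (fst i * snd i)) 1 = 0"
    by simp
  then show "p i = 0"
    unfolding q_def mult.assoc laurent_single_mult_inverse by simp
qed

lemmas tmon_indep = independent_family_independent[OF tmon_independent]
lemmas inj_tmon = independent_family_inj[OF tmon_independent]

abbreviation torus :: "'a set" where "torus \<equiv> L.span (range tmon)"

definition coef :: "'a \<Rightarrow> int \<times> int \<Rightarrow> laurent" where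
  "coef x a = L.representation (range tmon) x (tmon a)"

lemma coef_0 [simp]: "coef 0 a = 0"
  by (simp add: coef_def L.representation_zero)

lemma coef_add: "x \<in> torus \<Longrightarrow> y \<in> torus \<Longrightarrow> coef (x + y) a = coef x a + coef y a"
  by (simp add: coef_def L.representation_add[OF tmon_indep])

lemma coef_diff: "x \<in> torus \<Longrightarrow> y \<in> torus \<Longrightarrow> coef (x - y) a = coef x a - coef y a"
  by (simp add: coef_def L.representation_diff[OF tmon_indep])

lemma coef_lscale: "x \<in> torus \<Longrightarrow> coef (lscale v p x) a = p * coef x a"
  by (simp add: coef_def L.representation_scale[OF tmon_indep])

lemma coef_sum: "(\<And>i. i \<in> I \<Longrightarrow> f i \<in> torus) \<Longrightarrow> coef (sum f I) a = (\<Sum>i\<in>I. coef (f i) a)"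
  by (induction I rule: infinite_finite_induct) (simp_all add: coef_add L.span_sum)

lemma coef_tmon: "coef (tmon b) a = (if a = b then 1 else 0)"
  using inj_tmon by (simp add: coef_def L.representation_basis[OF tmon_indep] inj_eq)

lemma finite_coef: "finite {a. coef x a \<noteq> 0}"
  using finite_vimageI[OF L.finite_representation[of "range tmon" x] inj_tmon]
  by (simp add: coef_def vimage_def)

lemma tmon_torus: "tmon a \<in> torus"
  by (rule L.span_base) simp

section \<open>The filtration of the quantum torus by total degree\<close>

definition higher :: "int \<Rightarrow> 'a set" where
  "higher k = L.span (tmon ` {a. k \<le> fst a + snd a})"

lemma higher_torus: "higher k \<subseteq> torus"
  unfolding higher_def by (rule L.span_mono) auto

lemma higher_mono: "k \<ge> l \<Longrightarrow> higher k \<subseteq> higher l"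
  unfolding higher_def by (rule L.span_mono) auto

lemma tmon_higher: "k \<le> fst a + snd a \<Longrightarrow> tmon a \<in> higher k"
  unfolding higher_def by (rule L.span_base) auto

lemma scale_higher: "x \<in> higher k \<Longrightarrow> l \<odot> x \<in> higher k"
  unfolding higher_def by (rule scale_in_span)

lemma mult_higher:
  assumes "x \<in> higher k" "y \<in> higher l"
  shows "x * y \<in> higher (k + l)"
  using assms(1)[unfolded higher_def]
proof (induction rule: L.span_induct_alt)
  case base
  then show ?case by (simp add: higher_def L.span_zero)
next
  case (step c x x')
  have "x * y \<in> higher (k + l)"
    using assms(2)[unfolded higher_def]
  proof (induction rule: L.span_induct_alt)
    case base
    then show ?case by (simp add: higher_def L.span_zero)
  next
    case (step d y y')
    obtain a b where "x = tmon a" "y = tmon b" "k \<le> fst a + snd a" "l \<le> fst b + snd b"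
      using \<open>x \<in> _\<close> step(1) by auto
    then have "x * y \<in> higher (k + l)"
      by (cases a; cases b) (auto simp: tmon_mult intro!: scale_higher tmon_higher)
    with step(2) show ?case
      by (simp add: distrib_left mult_lscale higher_def L.span_add L.span_scale)
  qed
  with step(2) show ?case
    by (simp add: distrib_right lscale_mult higher_def L.span_add L.span_scale)
qed

text \<open>Closure is read off \<open>mult_higher\<close>, since every element of the torus lies in
  some step of the filtration.\<close>

lemma torus_mult:
  assumes "x \<in> torus" "y \<in> torus"
  shows "x * y \<in> torus"
proof -
  have "\<exists>k. x \<in> higher k" if "x \<in> torus" for x
    using that
  proof (induction rule: L.span_induct_alt)
    case base
    then show ?case by (auto simp: higher_def L.span_zero)
  next
    case (step c x y)
    then obtain a k where a: "x = tmon a" and k: "y \<in> higher k" by blast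
    define l where "l = min k (fst a + snd a)"
    have "x \<in> higher l" "y \<in> higher l"
      using k higher_mono[of l k] by (auto simp: a l_def intro: tmon_higher)
    then show ?case
      by (auto simp: higher_def intro!: exI[of _ l] L.span_add L.span_scale)
  qed
  with assms mult_higher higher_torus show ?thesis
    by blast
qed

lemma coef_higher:
  assumes "x \<in> higher k" "fst a + snd a < k"
  shows "coef x a = 0"
proof -
  have "x \<in> torus \<and> coef x a = 0"
    using assms(1)[unfolded higher_def]
  proof (induction rule: L.span_induct_alt)
    case base
    show ?case by (simp add: L.span_zero)
  next
    case (step c x y)
    then have "x \<in> torus" "coef x a = 0"
      using assms(2) tmon_torus by (auto simp: coef_tmon)
    with step(2) show ?case
      by (simp add: coef_add coef_lscale L.span_add L.span_scale)
  qed
  then show ?thesis ..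
qed

definition lead :: "'a \<Rightarrow> int \<times> int \<Rightarrow> bool" where
  "lead x a \<longleftrightarrow> x - tmon a \<in> higher (fst a + snd a + 1)"

lemma lead_torus: "lead x a \<Longrightarrow> x \<in> torus"
  using L.span_add[OF subsetD[OF higher_torus] tmon_torus, of "x - tmon a" _ a]
  by (auto simp: lead_def)

lemma lead_higher:
  assumes "lead x a" "k \<le> fst a + snd a"
  shows "x \<in> higher k"
proof -
  have "x - tmon a \<in> higher k"
    using assms higher_mono[of k "fst a + snd a + 1"] by (auto simp: lead_def)
  moreover have "tmon a \<in> higher k"
    using assms(2) by (rule tmon_higher)
  ultimately have "(x - tmon a) + tmon a \<in> higher k"
    unfolding higher_def by (rule L.span_add)
  then show ?thesis by simp
qed

lemma lead_coef:
  assumes "lead x a" "fst b + snd b \<le> fst a + snd a"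
  shows "coef x b = (if b = a then 1 else 0)"
proof -
  have "coef (x - tmon a) b = 0"
    using assms by (intro coef_higher[of _ "fst a + snd a + 1"]) (auto simp: lead_def)
  then show ?thesis
    using coef_diff[OF lead_torus[OF assms(1)] tmon_torus, of a b] by (simp add: coef_tmon)
qed

lemma lead_tmon: "lead (tmon a) a"
  by (simp add: lead_def higher_def L.span_zero)

lemma lead_diff:
  assumes "lead x a" "y \<in> higher k" "fst a + snd a < k"
  shows "lead (x - y) a"
proof -
  have "y \<in> higher (fst a + snd a + 1)"
    using assms(2,3) higher_mono[of "fst a + snd a + 1" k] by auto
  with assms(1) have "(x - tmon a) - y \<in> higher (fst a + snd a + 1)"
    unfolding lead_def higher_def by (rule L.span_diff)
  then show ?thesis
    by (simp add: lead_def algebra_simps)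
qed

lemma lead_mult:
  assumes "lead x (a, b)" "lead y (c, d)"
  shows "lead ((a * d - b * c) \<odot> (x * y)) (a + c, b + d)"
proof -
  define u where "u = x - tmon (a, b)"
  define w where "w = y - tmon (c, d)"
  have u: "u \<in> higher (a + b + 1)" and w: "w \<in> higher (c + d + 1)"
    using assms by (simp_all add: lead_def u_def w_def)
  have "x * y = tmon (a, b) * tmon (c, d) + (tmon (a, b) * w + u * y)"
    by (simp add: u_def w_def algebra_simps)
  then have "(a * d - b * c) \<odot> (x * y) - tmon (a + c, b + d) = (a * d - b * c) \<odot> (tmon (a, b) * w + u * y)"
    by (simp add: scale_add tmon_mult)
  also have "\<dots> \<in> higher (a + c + (b + d) + 1)"
  proof (intro scale_higher)
    have "tmon (a, b) * w \<in> higher ((a + b) + (c + d + 1))"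
      by (intro mult_higher w tmon_higher) simp
    moreover have "u * y \<in> higher ((a + b + 1) + (c + d))"
      by (intro mult_higher u lead_higher[OF assms(2)]) simp
    moreover have "(a + b) + (c + d + 1) = a + c + (b + d) + 1" "(a + b + 1) + (c + d) = a + c + (b + d) + 1"
      by simp_all
    ultimately show "tmon (a, b) * w + u * y \<in> higher (a + c + (b + d) + 1)"
      unfolding higher_def by (simp only: L.span_add)
  qed
  finally show ?thesis
    by (simp add: lead_def)
qed

lemma lead_mult_eq:
  assumes "lead x (a, b)" "lead y (c, d)" "k = a * d - b * c" "e = (a + c, b + d)"
  shows "lead (k \<odot> (x * y)) e"
  using lead_mult[OF assms(1,2)] assms(3,4) by simp

lemma lead_power:
  assumes "lead x (a, b)"
  shows "lead (x ^ n) (int n * a, int n * b)"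
proof (induction n)
  case 0
  show ?case using lead_tmon[of "(0, 0)"] by (simp add: tmon_0)
next
  case (Suc n)
  from lead_mult_eq[OF assms Suc, of 0 "(int (Suc n) * a, int (Suc n) * b)"] show ?case
    by (simp add: algebra_simps)
qed

text \<open>Among the indices with nonzero coefficient take \<open>j\<close> of least total degree.
  By \<open>lead_coef\<close> no other member of the sum contributes to the coefficient of tmon j,
  even when its index has the same total degree.\<close>

lemma lead_independent_family:
  assumes "\<And>a. lead (F a) a"
  shows "independent_family F"
  unfolding independent_family_def
proof (intro allI impI ballI, rule ccontr)
  fix I :: "(int \<times> int) set" and p i
  assume I: "finite I" "(\<Sum>i\<in>I. lscale v (p i) (F i)) = 0" and i: "i \<in> I" "p i \<noteq> 0"
  define J where "J = {i \<in> I. p i \<noteq> 0}"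
  have "finite J" "i \<in> J" using I i by (simp_all add: J_def)
  then have "J \<noteq> {}" by blast
  with \<open>finite J\<close> obtain j where j: "j \<in> J" "\<And>l. l \<in> J \<Longrightarrow> fst j + snd j \<le> fst l + snd l"
    using ex_min_if_finite[of "(\<lambda>l. fst l + snd l) ` J"] by (force simp: not_less)
  have "0 = coef (\<Sum>i\<in>I. lscale v (p i) (F i)) j"
    by (simp add: I(2))
  also have "\<dots> = (\<Sum>i\<in>I. p i * coef (F i) j)"
    by (subst coef_sum) (auto intro!: L.span_scale lead_torus[OF assms] sum.cong simp: coef_lscale lead_torus[OF assms])
  also have "\<dots> = (\<Sum>i\<in>{j}. p i)"
  proof (rule sum.mono_neutral_cong_right)
    show "\<forall>i\<in>I - {j}. p i * coef (F i) j = 0"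
    proof
      fix i assume "i \<in> I - {j}"
      then show "p i * coef (F i) j = 0"
        using j(2)[of i] lead_coef[OF assms, of j i] by (cases "p i = 0") (auto simp: J_def)
    qed
  qed (use j(1) \<open>finite I\<close> in \<open>auto simp: J_def lead_coef[OF assms]\<close>)
  finally show False
    using j(1) by (simp add: J_def)
qed

text \<open>Multiplication by X 1 on the left and X 2 on the right clears the denominators; then
  \<open>z_left\<close> and one exchange relation decide the identity.\<close>

lemma z_tmon: "z = tmon (-1, 1) + tmon (1, -1) + tmon (-1, -1)"
proof -
  have "X 1 * (tmon (-1, 1) + tmon (1, -1) + tmon (-1, -1)) * X 2 =
      (-1) \<odot> X 2 ^ 2 + (-1) \<odot> X 1 ^ 2 + 1 \<odot> 1"
  proof -
    have "X 1 * tmon (-1, 1) * X 2 = (-1) \<odot> ((X 1 * inverse (X 1)) * X 2 ^ 2)"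
      "X 1 * tmon (1, -1) * X 2 = (-1) \<odot> (X 1 ^ 2 * (inverse (X 2) * X 2))"
      "X 1 * tmon (-1, -1) * X 2 = 1 \<odot> ((X 1 * inverse (X 1)) * (inverse (X 2) * X 2))"
      by (simp_all add: tmon_def mult.assoc power2_eq_square power_int_minus)
    then show ?thesis
      using initial_seed by (simp add: distrib_left distrib_right)
  qed
  also have "\<dots> = X 1 * (z * X 2)"
    using exchange'[of 2] by (simp add: z_left distrib_left scale_add power2_eq_square add_ac)
  finally have "X 1 * (tmon (-1, 1) + tmon (1, -1) + tmon (-1, -1)) * X 2 = X 1 * z * X 2"
    by (simp only: mult.assoc)
  then show ?thesis
    by (simp only: mult_right_cancel[OF initial_seed(2)] mult_left_cancel[OF initial_seed(1)])
qed

lemma lead_z: "lead z (-1, -1)"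
proof -
  have "z - tmon (-1, -1) = tmon (-1, 1) + tmon (1, -1)"
    by (simp add: z_tmon)
  also have "\<dots> \<in> higher (-1)"
    unfolding higher_def by (intro L.span_add L.span_base) auto
  finally show ?thesis by (simp add: lead_def)
qed

section \<open>The bar involution on the quantum torus\<close>

definition tbar :: "'a \<Rightarrow> 'a" where
  "tbar x = (\<Sum>a | coef x a \<noteq> 0. lscale v (laurent_bar (coef x a)) (tmon a))"

lemma tbar_eq:
  assumes "finite A" "\<And>a. coef x a \<noteq> 0 \<Longrightarrow> a \<in> A"
  shows "tbar x = (\<Sum>a\<in>A. lscale v (laurent_bar (coef x a)) (tmon a))"
  unfolding tbar_def using assms by (intro sum.mono_neutral_left) auto

lemma tbar_0 [simp]: "tbar 0 = 0"
  by (simp add: tbar_def)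

lemma tbar_add:
  assumes "x \<in> torus" "y \<in> torus"
  shows "tbar (x + y) = tbar x + tbar y"
proof -
  define A where "A = {a. coef x a \<noteq> 0} \<union> {a. coef y a \<noteq> 0} \<union> {a. coef (x + y) a \<noteq> 0}"
  have fin: "finite A" by (simp add: A_def finite_coef)
  have "tbar x = (\<Sum>a\<in>A. lscale v (laurent_bar (coef x a)) (tmon a))"
    "tbar y = (\<Sum>a\<in>A. lscale v (laurent_bar (coef y a)) (tmon a))"
    "tbar (x + y) = (\<Sum>a\<in>A. lscale v (laurent_bar (coef (x + y) a)) (tmon a))"
    by (intro tbar_eq fin; simp add: A_def)+
  then show ?thesis
    using assms by (simp add: coef_add laurent_bar_add L.scale_left_distrib sum.distrib)
qed

lemma tbar_lscale:
  assumes "x \<in> torus"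
  shows "tbar (lscale v p x) = lscale v (laurent_bar p) (tbar x)"
proof -
  have "tbar (lscale v p x) = (\<Sum>a | coef x a \<noteq> 0. lscale v (laurent_bar (coef (lscale v p x) a)) (tmon a))"
    by (rule tbar_eq) (use assms in \<open>auto simp: finite_coef coef_lscale\<close>)
  then show ?thesis
    using assms by (simp add: tbar_def coef_lscale laurent_bar_mult L.scale_sum_right)
qed

lemma tbar_scale: "x \<in> torus \<Longrightarrow> tbar (k \<odot> x) = (- k) \<odot> tbar x"
  using tbar_lscale[of x "Poly_Mapping.single k 1"] by (simp add: lscale_single laurent_bar_single)

lemma tbar_tmon: "tbar (tmon a) = tmon a"
proof -
  have "tbar (tmon a) = (\<Sum>b\<in>{a}. lscale v (laurent_bar (coef (tmon a) b)) (tmon b))"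
    by (rule tbar_eq) (auto simp: coef_tmon split: if_splits)
  then show ?thesis
    using laurent_bar_single[of 0 1] by (simp add: coef_tmon)
qed

lemma tbar_torus: "tbar x \<in> torus"
  unfolding tbar_def by (intro L.span_sum L.span_scale tmon_torus)

lemma tbar_tbar:
  assumes "x \<in> torus"
  shows "tbar (tbar x) = x"
proof -
  have "x \<in> torus \<and> tbar (tbar x) = x"
    using assms
  proof (induction rule: L.span_induct_alt)
    case base
    then show ?case by (simp add: L.span_zero)
  next
    case (step c x y)
    then obtain a where "x = tmon a" by blast
    with step(2) show ?case
      by (simp add: tmon_torus tbar_torus tbar_add tbar_lscale tbar_tmon L.span_add L.span_scale)
  qed
  then show ?thesis ..
qed

text \<open>On monomials, swapping the factors negates the skew form in \<open>tmon_mult\<close>,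
  and so does inverting v.\<close>

lemma tbar_mult:
  assumes "x \<in> torus" "y \<in> torus"
  shows "tbar (x * y) = tbar y * tbar x"
proof -
  have tmon: "y \<in> torus \<and> tbar (tmon a * y) = tbar y * tmon a" if "y \<in> torus" for y a
    using that
  proof (induction rule: L.span_induct_alt)
    case base
    then show ?case by (simp add: L.span_zero)
  next
    case (step c x y)
    then obtain b where b: "x = tmon b" by blast
    have "tbar (tmon a * tmon b) = tmon b * tmon a"
      by (cases a; cases b) (simp add: tmon_mult tbar_scale tmon_torus tbar_tmon algebra_simps)
    with step(2) b show ?case
      by (simp add: distrib_left distrib_right mult_lscale lscale_mult tbar_add tbar_lscale tbar_tmon
          tmon_torus torus_mult L.span_add L.span_scale)
  qed
  have "x \<in> torus \<and> tbar (x * y) = tbar y * tbar x"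
    using assms(1)
  proof (induction rule: L.span_induct_alt)
    case base
    then show ?case by (simp add: L.span_zero)
  next
    case (step c x x')
    then obtain a where a: "x = tmon a" by blast
    with step(2) tmon[OF assms(2), of a] assms(2) show ?case
      by (simp add: distrib_left distrib_right mult_lscale lscale_mult tbar_add tbar_lscale tbar_tmon
          tmon_torus torus_mult L.span_add L.span_scale)
  qed
  then show ?thesis ..
qed

lemma tbar_z: "tbar z = z"
  by (simp add: z_tmon tbar_add tbar_tmon tmon_torus L.span_add)

lemma tbar_diff: "x \<in> torus \<Longrightarrow> y \<in> torus \<Longrightarrow> tbar (x - y) = tbar x - tbar y"
  using tbar_add[of "x - y" y] by (simp add: L.span_diff)

definition cluster_variable_prop :: "int \<Rightarrow> bool" where
  "cluster_variable_prop m \<longleftrightarrow> lead (X m) (1 - \<bar>m - 1\<bar>, 1 - \<bar>m - 2\<bar>) \<and> tbar (X m) = X m"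

text \<open>The recursion by \<open>z\<close> needs two consecutive variables. The factor
  \<open>z\<close> lowers both exponents by 1, so its term determines the lowest term; and the bar
  turns the recursion from \<open>z_left\<close> into the one from \<open>z_right\<close>.\<close>

lemma cluster_variable_prop_pair: "cluster_variable_prop m \<and> cluster_variable_prop (m + 1)"
proof (induction m rule: int_induct[where k = 1])
  case base
  show ?case
    using lead_tmon[of "(1, 0)"] lead_tmon[of "(0, 1)"] tbar_tmon[of "(1, 0)"] tbar_tmon[of "(0, 1)"]
    by (simp add: cluster_variable_prop_def tmon_1 tmon_2)
next
  case (step1 m)
  then have lead: "lead (X m) (2 - m, 1 - \<bar>m - 2\<bar>)" "lead (X (m + 1)) (1 - m, 2 - m)"
    and bar: "tbar (X m) = X m" "tbar (X (m + 1)) = X (m + 1)"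
    by (simp_all add: cluster_variable_prop_def)
  have eq: "X (m + 1 + 1) = (-1) \<odot> (z * X (m + 1)) - (-2) \<odot> X m"
    by (simp add: z_left scale_add)
  have "lead ((-1) \<odot> (z * X (m + 1))) (- m, 1 - m)"
    by (rule lead_mult_eq[OF lead_z lead(2)]) simp_all
  then have "lead (X (m + 1 + 1)) (- m, 1 - m)"
    unfolding eq by (rule lead_diff[OF _ scale_higher[OF lead_higher[OF lead(1) order_refl]]]) (use step1 in simp)
  moreover have "tbar (X (m + 1 + 1)) = 1 \<odot> (X (m + 1) * z) - 2 \<odot> X m"
    unfolding eq using lead[THEN lead_torus] lead_torus[OF lead_z]
    by (simp add: tbar_diff tbar_scale tbar_mult torus_mult scale_in_span tbar_z bar)
  then have "tbar (X (m + 1 + 1)) = X (m + 1 + 1)"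
    by (simp add: z_right scale_add)
  ultimately show ?case
    using step1 by (simp add: cluster_variable_prop_def)
next
  case (step2 m)
  then have lead: "lead (X m) (m, m - 1)" "lead (X (m + 1)) (1 - \<bar>m\<bar>, m)"
    and bar: "tbar (X m) = X m" "tbar (X (m + 1)) = X (m + 1)"
    by (simp_all add: cluster_variable_prop_def)
  have eq: "X (m - 1) = (-1) \<odot> (X m * z) - (-2) \<odot> X (m + 1)"
    by (simp add: z_right scale_add)
  have "lead ((-1) \<odot> (X m * z)) (m - 1, m - 2)"
    by (rule lead_mult_eq[OF lead(1) lead_z]) simp_all
  then have "lead (X (m - 1)) (m - 1, m - 2)"
    unfolding eq by (rule lead_diff[OF _ scale_higher[OF lead_higher[OF lead(2) order_refl]]]) (use step2 in simp)
  moreover have "tbar (X (m - 1)) = 1 \<odot> (z * X m) - 2 \<odot> X (m + 1)"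
    unfolding eq using lead[THEN lead_torus] lead_torus[OF lead_z]
    by (simp add: tbar_diff tbar_scale tbar_mult torus_mult scale_in_span tbar_z bar)
  then have "tbar (X (m - 1)) = X (m - 1)"
    by (simp add: z_left scale_add)
  ultimately show ?case
    using step2 by (simp add: cluster_variable_prop_def)
qed

lemma lead_X: "lead (X m) (1 - \<bar>m - 1\<bar>, 1 - \<bar>m - 2\<bar>)"
  and tbar_X: "tbar (X m) = X m"
  using cluster_variable_prop_pair[of m] by (simp_all add: cluster_variable_prop_def)

lemmas X_torus = lead_torus[OF lead_X]

lemma power_torus: "x \<in> torus \<Longrightarrow> x ^ n \<in> torus"
  by (induction n) (use tmon_torus[of "(0, 0)"] in \<open>auto simp: tmon_0 torus_mult\<close>)

lemma tbar_1: "tbar 1 = 1"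
  using tbar_tmon[of "(0, 0)"] by (simp add: tmon_0)

lemma tbar_power: "x \<in> torus \<Longrightarrow> tbar (x ^ n) = tbar x ^ n"
  by (induction n) (simp_all add: tbar_1 tbar_mult power_torus power_commutes)

lemma tbar_S: "tbar (S r) = S r"
proof -
  have "S r \<in> torus \<and> tbar (S r) = S r"
  proof (induction r rule: less_induct)
    case (less r)
    consider "r = 0" | "r = 1" | e where "r = Suc (Suc e)"
      by (metis One_nat_def not0_implies_Suc)
    then show ?case
    proof cases
      case 1
      then show ?thesis using tmon_torus[of "(0, 0)"] by (simp add: tbar_1 tmon_0)
    next
      case 2
      then show ?thesis by (simp add: tbar_z lead_torus[OF lead_z])
    next
      case 3
      with less[of e] less[of "Suc e"] show ?thesis
        by (simp add: tbar_diff tbar_mult tbar_z lead_torus[OF lead_z] torus_mult L.span_diff S_commute)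
    qed
  qed
  then show ?thesis ..
qed

lemma lead_S: "lead (S r) (- int r, - int r)"
proof (induction r rule: less_induct)
  case (less r)
  consider "r = 0" | "r = 1" | e where "r = Suc (Suc e)"
    by (metis One_nat_def not0_implies_Suc)
  then show ?case
  proof cases
    case 1
    then show ?thesis using lead_tmon[of "(0, 0)"] by (simp add: tmon_0)
  next
    case 2
    then show ?thesis by (simp add: lead_z)
  next
    case 3
    have "lead (0 \<odot> (z * S (Suc e))) (- int r, - int r)"
      by (rule lead_mult_eq[OF lead_z less]) (simp_all add: 3)
    then have "lead (0 \<odot> (z * S (Suc e)) - S e) (- int r, - int r)"
      by (rule lead_diff[OF _ lead_higher[OF less order_refl]]) (simp_all add: 3)
    with 3 show ?thesis by simp
  qed
qed

lemma lead_cluster_monomial: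
  "lead (cluster_monomial v X m p q)
     (int p * (1 - \<bar>m - 1\<bar>) + int q * (1 - \<bar>m\<bar>), int p * (1 - \<bar>m - 2\<bar>) + int q * (1 - \<bar>m - 1\<bar>))"
proof -
  have 1: "lead (X m ^ p) (int p * (1 - \<bar>m - 1\<bar>), int p * (1 - \<bar>m - 2\<bar>))"
    by (rule lead_power) (rule lead_X)
  have "lead (X (m + 1)) (1 - \<bar>m\<bar>, 1 - \<bar>m - 1\<bar>)"
    using lead_X[of "m + 1"] by (simp add: algebra_simps)
  then have 2: "lead (X (m + 1) ^ q) (int q * (1 - \<bar>m\<bar>), int q * (1 - \<bar>m - 1\<bar>))"
    by (rule lead_power)
  \<comment> \<open>The lowest exponents of X m and X (m + 1) have determinant 1. This is why the
    normalising factor v^(pq) is the right one for every cluster.\<close>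
  have "(1 - \<bar>m - 1\<bar>) * (1 - \<bar>m - 1\<bar>) - (1 - \<bar>m - 2\<bar>) * (1 - \<bar>m\<bar>) = 1"
  proof -
    consider "m \<le> 0" | "m = 1" | "m \<ge> 2" by linarith
    then show ?thesis by cases (simp_all add: algebra_simps)
  qed
  then have "int p * int q = int p * int q * ((1 - \<bar>m - 1\<bar>) * (1 - \<bar>m - 1\<bar>) - (1 - \<bar>m - 2\<bar>) * (1 - \<bar>m\<bar>))"
    by simp
  moreover have "a * g1 * (b * h2) - a * g2 * (b * h1) = a * b * (g1 * h2 - g2 * h1)" for a b g1 g2 h1 h2 :: int
    by (simp add: algebra_simps)
  ultimately have "int p * int q = int p * (1 - \<bar>m - 1\<bar>) * (int q * (1 - \<bar>m - 1\<bar>)) -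
      int p * (1 - \<bar>m - 2\<bar>) * (int q * (1 - \<bar>m\<bar>))"
    by simp
  from lead_mult_eq[OF 1 2 this refl] show ?thesis
    by (simp add: cluster_monomial_eq)
qed

lemma ht_monomial:
  "ht (p + q) (m * int (p + q) + int q) j = int p * (\<bar>m - j - 1\<bar> - 1) + int q * (\<bar>m - j\<bar> - 1)"
proof -
  define D where "D = m - j - 1"
  have eq: "m * int (p + q) + int q - int (p + q) * (j + 1) = int p * D + int q * (D + 1)"
    by (simp add: D_def algebra_simps)
  have "\<bar>int p * D + int q * (D + 1)\<bar> = int p * \<bar>D\<bar> + int q * \<bar>D + 1\<bar>"
  proof (cases "D \<ge> 0")
    case True
    then show ?thesis by simp
  next
    case False
    then have "int p * D \<le> 0" "int q * (D + 1) \<le> 0"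
      by (simp_all add: mult_nonneg_nonpos)
    with False show ?thesis by (simp add: abs_of_nonpos) (simp add: algebra_simps)
  qed
  then show ?thesis
    unfolding ht_def eq by (simp add: D_def algebra_simps)
qed

lemma lead_basis_elt: "lead (basis_elt n s) (- ht n s 0, - ht n s 1)"
proof (cases "n = 0")
  case True
  then show ?thesis
    using lead_S[of "nat \<bar>s\<bar>"] by (simp add: basis_elt_0 ht_def)
next
  case False
  then obtain k where n: "n = Suc k" using not0_implies_Suc by blast
  obtain m q where q: "q \<le> k" and s: "s = m * (int k + 1) + int q"
    by (rule decompose)
  define p where "p = Suc k - q"
  have n: "n = p + q" and s: "s = m * int (p + q) + int q"
    using q by (simp_all add: n s p_def)
  have "- ht n s 0 = int p * (1 - \<bar>m - 1\<bar>) + int q * (1 - \<bar>m\<bar>)"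
    "- ht n s 1 = int p * (1 - \<bar>m - 2\<bar>) + int q * (1 - \<bar>m - 1\<bar>)"
    unfolding n s ht_monomial by (simp_all add: algebra_simps)
  then show ?thesis
    using lead_cluster_monomial[of m p q] unfolding n s basis_elt_monomial by simp
qed

lemma tbar_basis_elt: "tbar (basis_elt n s) = basis_elt n s"
proof (cases "n = 0")
  case True
  then show ?thesis by (simp add: basis_elt_0 tbar_S)
next
  case False
  have "tbar (cluster_monomial v X m p q) = cluster_monomial v X m p q" for m p q
    unfolding cluster_monomial_eq
    by (simp add: tbar_scale tbar_mult torus_mult power_torus X_torus tbar_power tbar_X power_commutation)
  with False show ?thesis by (simp add: basis_elt_def)
qed

end

section \<open>The canonical triangular basis\<close>

context quantum_cluster_A11
begin

text \<open>By \<open>ht_label\<close> and \<open>lead_basis_elt\<close>, \<open>label a\<close> is the index of the basis element with lowest term \<open>tmon a\<close>.\<close>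

definition label :: "int \<times> int \<Rightarrow> nat \<times> int" where
  "label = (\<lambda>(a1, a2).
     if a1 \<ge> 0 \<and> a2 \<ge> 0 then (nat (a1 + a2), a1 + 2 * a2)
     else if a1 \<le> a2 then (nat (a2 - a1), 2 * a2 - 3 * a1)
     else (nat (a1 - a2), a1))"

definition triangular_elt :: "int \<times> int \<Rightarrow> 'a" where
  "triangular_elt a = basis_elt (fst (label a)) (snd (label a))"

lemma ht_label:
  "ht (fst (label a)) (snd (label a)) 0 = - fst a" "ht (fst (label a)) (snd (label a)) 1 = - snd a"
  by (cases a; auto simp: label_def ht_def)+

text \<open>For n > 0 the three ranges of \<open>s\<close> correspond to clusters at or left of {X
  0, X 1}, the initial cluster, and those right of it, up to powers of a shared variable. For
  \<open>n = 0\<close> the label carries a non-negative \<open>s\<close>, and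
  \<open>basis_elt\<close> does not distinguish s from -s.\<close>

lemma basis_elt_eq_triangular_elt: "basis_elt n s = triangular_elt (- ht n s 0, - ht n s 1)"
proof -
  consider "n = 0" | "n > 0" "s < int n" | "n > 0" "int n \<le> s" "s \<le> 2 * int n" | "n > 0" "2 * int n < s"
    by linarith
  then show ?thesis
  proof cases
    case 1
    then show ?thesis by (auto simp: triangular_elt_def label_def ht_def basis_elt_0)
  qed (auto simp: triangular_elt_def label_def ht_def)
qed

lemma lead_triangular_elt: "lead (triangular_elt a) a"
  using lead_basis_elt[of "fst (label a)" "snd (label a)"]
  by (simp add: triangular_elt_def ht_label)

lemma tbar_triangular_elt: "tbar (triangular_elt a) = triangular_elt a"
  by (simp add: triangular_elt_def tbar_basis_elt)

lemmas triangular_elt_torus = lead_torus[OF lead_triangular_elt]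
lemmas triangular_elt_independent = lead_independent_family[of triangular_elt, OF lead_triangular_elt]

section \<open>Standard elements and their triangular expansion\<close>

abbreviation E :: "int \<times> int \<Rightarrow> 'a" where "E \<equiv> standard_elt v X"

lemma E_eq: "E (a1, a2) =
    (a1 * a2) \<odot> (X 3 ^ nat (- a1) * X 1 ^ nat a1 * (X 2 ^ nat a2 * X 0 ^ nat (- a2)))"
  by (simp add: standard_elt_def scale_def mult.assoc)

lemma lead_E: "lead (E a) a"
proof -
  obtain a1 a2 where a: "a = (a1, a2)" by (cases a)
  have "lead (0 \<odot> (X 3 ^ nat (- a1) * X 1 ^ nat a1)) (a1, 0)"
    by (rule lead_mult_eq[OF lead_power[OF lead_X] lead_power[OF lead_X]]) simp_all
  moreover have "lead (0 \<odot> (X 2 ^ nat a2 * X 0 ^ nat (- a2))) (0, a2)"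
    by (rule lead_mult_eq[OF lead_power[OF lead_X] lead_power[OF lead_X]]) simp_all
  ultimately have "lead ((a1 * a2) \<odot> (0 \<odot> (X 3 ^ nat (- a1) * X 1 ^ nat a1) *
      (0 \<odot> (X 2 ^ nat a2 * X 0 ^ nat (- a2))))) (a1, a2)"
    by (rule lead_mult_eq) simp_all
  then show ?thesis by (simp add: a E_eq)
qed

text \<open>Outside the negative quadrant the factors of E a lie in one of the clusters {X 1, X 2},
  {X 0, X 1}, {X 2, X 3}.\<close>

lemma E_eq_triangular_elt:
  assumes "fst a \<ge> 0 \<or> snd a \<ge> 0"
  shows "E a = triangular_elt a"
proof -
  obtain a1 a2 where a: "a = (a1, a2)" by (cases a)
  consider p q where "a1 = int p" "a2 = int q" | p q where "a1 = int p" "a2 = - int q" "q > 0"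
    | p q where "a1 = - int p" "a2 = int q" "p > 0"
  proof -
    consider "a1 \<ge> 0" "a2 \<ge> 0" | "a1 \<ge> 0" "a2 < 0" | "a1 < 0" "a2 \<ge> 0"
      using assms unfolding a fst_conv snd_conv by linarith
    then show thesis
      by cases (use that(1)[of "nat a1" "nat a2"] that(2)[of "nat a1" "nat (- a2)"] that(3)[of "nat (- a1)" "nat a2"] in simp_all)
  qed
  then show ?thesis
  proof cases
    case 1
    have "triangular_elt a = cluster_monomial v X 1 p q"
      unfolding triangular_elt_def by (rule basis_elt_monomial_eq) (simp_all add: a 1 label_def nat_int_add add.commute)
    then show ?thesis
      by (simp add: a 1 E_eq cluster_monomial_eq)
  next
    case 2
    have "triangular_elt a = cluster_monomial v X 0 q p"
      unfolding triangular_elt_def by (rule basis_elt_monomial_eq) (simp_all add: a 2 label_def nat_int_add add.commute)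
    then show ?thesis
      by (simp add: a 2 E_eq cluster_monomial_eq' mult.commute)
  next
    case 3
    have "triangular_elt a = cluster_monomial v X 2 q p"
      unfolding triangular_elt_def by (rule basis_elt_monomial_eq) (simp_all add: a 3 label_def nat_int_add add.commute)
    then show ?thesis
      by (simp add: a 3 E_eq cluster_monomial_eq' mult.commute)
  qed
qed

text \<open>What is left of the bounds in \<open>low\<close> when only \<open>j = 0\<close> and
  \<open>j = 1\<close> are kept, with signs reversed: a coordinatewise order on lowest
  exponents.\<close>

definition above :: "int \<times> int \<Rightarrow> 'a set" where
  "above a = lattice (triangular_elt ` {b. fst a \<le> fst b \<and> snd a \<le> snd b})"

lemma above_mono: "fst b \<le> fst a \<Longrightarrow> snd b \<le> snd a \<Longrightarrow> above a \<subseteq> above b"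
  unfolding above_def by (rule lattice_mono) auto

lemma low_above: "low H \<subseteq> above (- H 0, - H 1)"
  unfolding low_def above_def
proof (rule lattice_mono, safe)
  fix n s assume "\<forall>j. ht n s j \<le> H j"
  then have "(- ht n s 0, - ht n s 1) \<in> {b. fst (- H 0, - H 1) \<le> fst b \<and> snd (- H 0, - H 1) \<le> snd b}"
    by simp
  then show "basis_elt n s \<in> triangular_elt ` {b. fst (- H 0, - H 1) \<le> fst b \<and> snd (- H 0, - H 1) \<le> snd b}"
    unfolding basis_elt_eq_triangular_elt by (rule imageI)
qed

lemma triangular_elt_mult_X0:
  obtains y where "y \<in> above (a1, a2 - 1)"
    "(- a1) \<odot> (triangular_elt (a1, a2) * X 0) = leading_elt (fst (label (a1, a2))) (snd (label (a1, a2))) 0 + 1 \<odot> y"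
proof -
  define n where "n = fst (label (a1, a2))"
  define s where "s = snd (label (a1, a2))"
  have ht: "ht n s 0 = - a1" "ht n s 1 = - a2"
    by (simp_all add: n_def s_def ht_label)
  have "low (\<lambda>j. ht n s j + ht 1 0 j) \<subseteq> above (a1, a2 - 1)"
    using low_above[of "\<lambda>j. ht n s j + ht 1 0 j"] unfolding ht ht_1 by simp
  with good[of n s 0] that show thesis
    unfolding good_def ht by (auto simp: n_def s_def triangular_elt_def)
qed

lemma triangular_elt_mult_X0_above:
  "(- a1) \<odot> (triangular_elt (a1, a2) * X 0) \<in> above (a1, a2 - 1)"
proof -
  define n where "n = fst (label (a1, a2))"
  define s where "s = snd (label (a1, a2))"
  have ht: "ht n s 0 = - a1" "ht n s 1 = - a2"
    by (simp_all add: n_def s_def ht_label)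
  have "low (\<lambda>j. ht n s j + ht 1 0 j) \<subseteq> above (a1, a2 - 1)"
    using low_above[of "\<lambda>j. ht n s j + ht 1 0 j"] unfolding ht ht_1 by simp
  moreover have "ht n s 0 \<odot> (basis_elt n s * X 0) \<in> low (\<lambda>j. ht n s j + ht 1 0 j)"
    by (rule good_low[OF good]) auto
  ultimately show ?thesis
    unfolding ht by (auto simp: triangular_elt_def n_def s_def)
qed

lemma label_neg:
  assumes "p > 0"
  shows "k \<le> p \<Longrightarrow> label (- int p, - int k) = (p - k, 3 * int p - 2 * int k)"
    and "p < k \<Longrightarrow> label (- int p, - int k) = (k - p, - int p)"
  using assms by (auto simp: label_def nat_eq_iff of_nat_diff)

text \<open>A further factor X 0 lowers the second coordinate by one. The three cases are the
  branches of \<open>leading_elt\<close>: the degree falls until it is 0 on the diagonal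
  \<open>k = p\<close>, where the Chebyshev elements sit, and rises afterwards.\<close>

lemma leading_elt_label:
  assumes "p > 0"
  shows "leading_elt (fst (label (- int p, - int k))) (snd (label (- int p, - int k))) 0 =
     triangular_elt (- int p, - int (Suc k))"
proof -
  consider "k < p" | "k = p" | "p < k" by linarith
  then show ?thesis
  proof cases
    case 1
    then show ?thesis
      using label_neg(1)[OF assms, of k] label_neg(1)[OF assms, of "Suc k"]
      by (simp add: leading_elt_def triangular_elt_def of_nat_diff algebra_simps)
  next
    case 2
    then show ?thesis
      using label_neg(1)[OF assms, of k] label_neg(2)[OF assms, of "Suc k"]
      by (simp add: leading_elt_def triangular_elt_def)
  next
    case 3
    moreover from this have "Suc (k - p) = Suc k - p" by linarith
    ultimately show ?thesis
      using label_neg(2)[OF assms, of k] label_neg(2)[OF assms, of "Suc k"]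
      by (simp add: leading_elt_def triangular_elt_def of_nat_diff Suc_diff_le)
  qed
qed

lemma E_step: "E (a, - int (Suc k)) = (- a) \<odot> (E (a, - int k) * X 0)"
proof -
  have "nat (- (- int (Suc k))) = Suc k" "nat (- int (Suc k)) = 0" "nat (- (- int k)) = k" "nat (- int k) = 0"
    by simp_all
  moreover have "a * - int (Suc k) = - a + a * - int k"
    by (simp add: algebra_simps)
  ultimately show ?thesis
    unfolding E_eq by (simp only: power_Suc2 mult.assoc scale_mult_left scale_scale)
qed

lemma E_expansion_aux:
  assumes "p > 0"
  shows "\<exists>y\<in>above (- int p, - int k). E (- int p, - int k) = triangular_elt (- int p, - int k) + 1 \<odot> y"
proof (induction k)
  case 0
  show ?case
    by (rule bexI[of _ 0]) (simp_all add: E_eq_triangular_elt above_def lattice.zero)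
next
  case (Suc k)
  have idx: "- int k - 1 = - int (Suc k)" by simp
  obtain y where y: "y \<in> above (- int p, - int k)"
    "E (- int p, - int k) = triangular_elt (- int p, - int k) + 1 \<odot> y"
    using Suc by blast
  obtain w where w: "w \<in> above (- int p, - int (Suc k))"
    "int p \<odot> (triangular_elt (- int p, - int k) * X 0) = triangular_elt (- int p, - int (Suc k)) + 1 \<odot> w"
    using triangular_elt_mult_X0[of "- int p" "- int k"]
    unfolding leading_elt_label[OF assms] idx minus_minus by blast
  have "E (- int p, - int (Suc k)) = int p \<odot> (E (- int p, - int k) * X 0)"
    unfolding E_step minus_minus ..
  also have "\<dots> = int p \<odot> (triangular_elt (- int p, - int k) * X 0) + 1 \<odot> int p \<odot> (y * X 0)"
    unfolding y(2) by (simp only: distrib_right scale_add scale_mult_left scale_scale add.commute[of 1])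
  also have "\<dots> = triangular_elt (- int p, - int (Suc k)) + 1 \<odot> (w + int p \<odot> (y * X 0))"
    unfolding w(2) by (simp only: scale_add add.assoc)
  finally have "E (- int p, - int (Suc k)) = triangular_elt (- int p, - int (Suc k)) + 1 \<odot> (w + int p \<odot> (y * X 0))" .
  moreover have "int p \<odot> (y * X 0) \<in> above (- int p, - int (Suc k))"
    unfolding above_def
  proof (rule lattice_image[where f = "\<lambda>y. int p \<odot> (y * X 0)"])
    show "y \<in> lattice (triangular_elt ` {b. fst (- int p, - int k) \<le> fst b \<and> snd (- int p, - int k) \<le> snd b})"
      using y(1) unfolding above_def .
    fix g l assume "g \<in> triangular_elt ` {b. fst (- int p, - int k) \<le> fst b \<and> snd (- int p, - int k) \<le> snd b}" "(0::int) \<le> l"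
    then obtain b1 b2 where b: "g = triangular_elt (b1, b2)" "- int p \<le> b1" "- int k \<le> b2" and l: "0 \<le> l"
      by auto
    have "above (b1, b2 - 1) \<subseteq> above (- int p, - int (Suc k))"
      by (rule above_mono) (use b in simp_all)
    then have "(- b1) \<odot> (g * X 0) \<in> above (- int p, - int (Suc k))"
      unfolding b(1) using triangular_elt_mult_X0_above by blast
    \<comment> \<open>The factor triangular_elt (b1, b2) requires only the power -b1, and b1 \<ge>
      -p makes the surplus non-negative.\<close>
    then have "(l + int p + b1) \<odot> (- b1) \<odot> (g * X 0) \<in> above (- int p, - int (Suc k))"
      unfolding above_def by (rule lattice_scale) (use b l in simp)
    then show "l \<odot> int p \<odot> (g * X 0) \<in>
        lattice (triangular_elt ` {b. fst (- int p, - int (Suc k)) \<le> fst b \<and> snd (- int p, - int (Suc k)) \<le> snd b})"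
      unfolding above_def by simp
  qed (simp_all add: distrib_right scale_add add.commute)
  ultimately show ?case
    using w(1) lattice_add unfolding above_def by blast
qed

lemma E_expansion:
  obtains y where "y \<in> above a" "E a = triangular_elt a + 1 \<odot> y"
proof (cases "fst a \<ge> 0 \<or> snd a \<ge> 0")
  case True
  then show thesis
    using that[of 0] by (simp add: E_eq_triangular_elt above_def lattice.zero)
next
  case False
  then have "a = (- int (nat (- fst a)), - int (nat (- snd a)))" "nat (- fst a) > 0"
    by (cases a; simp)+
  then have "\<exists>y\<in>above a. E a = triangular_elt a + 1 \<odot> y"
    using E_expansion_aux[of "nat (- fst a)" "nat (- snd a)"] by (simp only:)
  then show thesis
    using that by blast
qed

lemma E_lattice: "E a \<in> lattice (range triangular_elt)"
proof -
  obtain y where y: "y \<in> above a" "E a = triangular_elt a + 1 \<odot> y"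
    by (rule E_expansion)
  have "y \<in> lattice (range triangular_elt)"
    using y(1) lattice_mono[of _ "range triangular_elt"] unfolding above_def by blast
  then show ?thesis
    unfolding y(2) by (auto intro!: lattice_add lattice_scale intro: lattice_base)
qed

lemma lattice_insert:
  assumes "x \<in> lattice (insert c G)"
  obtains r y where "y \<in> lattice G" "x = lscale v r c + y"
proof -
  have "\<exists>r. \<exists>y\<in>lattice G. x = lscale v r c + y"
    using assms
  proof induction
    case zero
    show ?case by (intro exI[of _ 0] bexI[of _ 0]) (simp_all add: lattice.zero)
  next
    case (plus x g k)
    then obtain r y where y: "y \<in> lattice G" "x = lscale v r c + y" by blast
    show ?case
    proof (cases "g = c")
      case True
      then have "x + k \<odot> g = lscale v (r + Poly_Mapping.single k 1) c + y"
        by (simp add: y(2) L.scale_left_distrib lscale_single)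
      with y(1) show ?thesis by blast
    next
      case False
      then have "y + k \<odot> g \<in> lattice G" using y(1) plus by (auto intro: lattice.plus)
      moreover have "x + k \<odot> g = lscale v r c + (y + k \<odot> g)" by (simp add: y(2))
      ultimately show ?thesis by blast
    qed
  next
    case (minus x g k)
    then obtain r y where y: "y \<in> lattice G" "x = lscale v r c + y" by blast
    show ?case
    proof (cases "g = c")
      case True
      then have "x - k \<odot> g = lscale v (r - Poly_Mapping.single k 1) c + y"
        by (simp add: y(2) L.scale_left_diff_distrib lscale_single)
      with y(1) show ?thesis by blast
    next
      case False
      then have "y - k \<odot> g \<in> lattice G" using y(1) minus by (auto intro: lattice.minus)
      moreover have "x - k \<odot> g = lscale v r c + (y - k \<odot> g)" by (simp add: y(2))
      ultimately show ?thesis by blast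
    qed
  qed
  then show thesis using that by blast
qed

text \<open>
  \<open>E_expansion\<close> could still involve \<open>triangular_elt a\<close> itself in \<open>y\<close>, where \<open>1 + v r\<close> would not be
  invertible over \<open>\<int>[v]\<close>; comparing the coefficients of \<open>tmon a\<close> excludes this.
\<close>

lemma triangular_elt_expansion:
  "\<exists>y\<in>lattice (range E). triangular_elt a = E a + 1 \<odot> y"
proof (induction "nat (- fst a) + nat (- snd a)" arbitrary: a rule: less_induct)
  case less
  show ?case
  proof (cases "fst a \<ge> 0 \<or> snd a \<ge> 0")
    case True
    then show ?thesis
      by (intro bexI[of _ 0]) (simp_all add: E_eq_triangular_elt lattice.zero)
  next
    case False
    define B where "B = {b. fst a \<le> fst b \<and> snd a \<le> snd b \<and> b \<noteq> a}"
    obtain y where y: "y \<in> above a" "E a = triangular_elt a + 1 \<odot> y"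
      by (rule E_expansion)
    have "{b. fst a \<le> fst b \<and> snd a \<le> snd b} = insert a B"
      by (auto simp: B_def)
    with y(1) have "y \<in> lattice (insert (triangular_elt a) (triangular_elt ` B))"
      by (simp add: above_def)
    then obtain r y' where y': "y' \<in> lattice (triangular_elt ` B)" "y = lscale v r (triangular_elt a) + y'"
      by (rule lattice_insert)
    have "triangular_elt ` B \<subseteq> higher (fst a + snd a + 1)"
    proof (rule image_subsetI)
      fix b assume "b \<in> B"
      then have "fst a + snd a + 1 \<le> fst b + snd b"
        by (cases a; cases b) (auto simp: B_def)
      then show "triangular_elt b \<in> higher (fst a + snd a + 1)"
        by (rule lead_higher[OF lead_triangular_elt])
    qed
    then have "L.span (triangular_elt ` B) \<subseteq> higher (fst a + snd a + 1)"
      unfolding higher_def by (intro L.span_minimal) auto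
    with y'(1) lattice_subset_span have y'_higher: "y' \<in> higher (fst a + snd a + 1)"
      by blast
    then have y'_coef: "coef y' a = 0" and y'_torus: "y' \<in> torus"
      using higher_torus by (auto intro: coef_higher)
    have "E a = triangular_elt a + lscale v (Poly_Mapping.single 1 1) (lscale v r (triangular_elt a) + y')"
      by (simp add: y(2) y'(2) lscale_single)
    then have "coef (E a) a = coef (triangular_elt a + lscale v (Poly_Mapping.single 1 1) (lscale v r (triangular_elt a) + y')) a"
      by simp
    then have "Poly_Mapping.single 1 1 * r = 0"
      using lead_coef[OF lead_E, of a a] lead_coef[OF lead_triangular_elt, of a a] y'_coef y'_torus triangular_elt_torus[of a]
      by (simp add: coef_add coef_lscale L.span_add L.span_scale)
    then have "Poly_Mapping.single (-1) 1 * Poly_Mapping.single 1 1 * r = 0"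
      by (simp add: mult.assoc)
    then have "r = 0"
      by (simp add: mult_single)
    then have "triangular_elt a = E a + 1 \<odot> (- y')"
      by (simp add: y(2) y'(2))
    moreover have "lattice (triangular_elt ` B) \<subseteq> lattice (range E)"
    proof (rule lattice_subset, rule image_subsetI)
      fix b assume b: "b \<in> B"
      \<comment> \<open>Both coordinates of \<open>a\<close> are negative, so raising either of them
        strictly decreases the measure, even past 0.\<close>
      then have "nat (- fst b) + nat (- snd b) < nat (- fst a) + nat (- snd a)"
        using False by (cases a; cases b) (auto simp: B_def)
      then obtain w where w: "w \<in> lattice (range E)" "triangular_elt b = E b + 1 \<odot> w"
        using less by blast
      then show "triangular_elt b \<in> lattice (range E)"
        unfolding w(2) by (auto intro!: lattice_add lattice_scale intro: lattice_base)
    qed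
    then have "- y' \<in> lattice (range E)"
      using y'(1) lattice_uminus by blast
    ultimately show ?thesis by blast
  qed
qed

section \<open>The cluster algebra as the span of the basis\<close>

abbreviation A :: "'a set" where "A \<equiv> cluster_algebra v X"

lemma A_X: "X m \<in> A"
  unfolding cluster_algebra_def by (rule laurent_subalgebra.gen) simp

lemma A_scalar: "eval_laurent v p \<in> A"
  unfolding cluster_algebra_def by (rule laurent_subalgebra.scalar)

lemma A_add: "x \<in> A \<Longrightarrow> y \<in> A \<Longrightarrow> x + y \<in> A"
  unfolding cluster_algebra_def by (rule laurent_subalgebra.add)

lemma A_mult: "x \<in> A \<Longrightarrow> y \<in> A \<Longrightarrow> x * y \<in> A"
  unfolding cluster_algebra_def by (rule laurent_subalgebra.mult)

lemma A_lscale: "x \<in> A \<Longrightarrow> lscale v p x \<in> A"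
  unfolding lscale_def by (intro A_mult A_scalar)

lemma A_power_int: "v powi k \<in> A"
  using A_scalar[of "Poly_Mapping.single k 1"] by (simp add: eval_laurent_single)

lemma A_scale: "x \<in> A \<Longrightarrow> k \<odot> x \<in> A"
  unfolding scale_def by (intro A_mult A_power_int)

lemma A_0: "0 \<in> A"
  using A_scalar[of 0] by simp

lemma A_1: "1 \<in> A"
  using A_power_int[of 0] by simp

lemma A_uminus: "x \<in> A \<Longrightarrow> - x \<in> A"
  using A_lscale[of x "- 1"] by simp

lemma A_diff: "x \<in> A \<Longrightarrow> y \<in> A \<Longrightarrow> x - y \<in> A"
  using A_add[OF _ A_uminus, of x y] by simp

lemma A_power: "x \<in> A \<Longrightarrow> x ^ n \<in> A"
  by (induction n) (auto intro: A_1 A_mult)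

lemma A_S: "S r \<in> A"
proof -
  have z: "z \<in> A"
    unfolding z_eq by (intro A_diff A_scale A_mult A_X)
  show ?thesis
  proof (induction r rule: less_induct)
    case (less r)
    consider "r = 0" | "r = 1" | e where "r = Suc (Suc e)"
      by (metis One_nat_def not0_implies_Suc)
    then show ?case
    proof cases
      case 3
      with less[of e] less[of "Suc e"] z show ?thesis
        by (simp add: A_diff A_mult)
    qed (simp_all add: A_1 z)
  qed
qed

lemma A_triangular_elt: "triangular_elt a \<in> A"
  unfolding triangular_elt_def basis_elt_def cluster_monomial_eq
  by (auto intro!: A_S A_scale A_mult A_power A_X)

lemma span_mult_X:
  assumes "x \<in> L.span (range triangular_elt)"
  shows "x * X m \<in> L.span (range triangular_elt)"
  using assms
proof (induction rule: L.span_induct_alt)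
  case base
  then show ?case by (simp add: L.span_zero)
next
  case (step c x y)
  obtain a where a: "x = triangular_elt a" using step(1) by blast
  define n where "n = fst (label a)"
  define s where "s = snd (label a)"
  have "low H \<subseteq> L.span (range triangular_elt)" for H
  proof -
    have "low H \<subseteq> lattice (range triangular_elt)"
      unfolding low_def using basis_elt_eq_triangular_elt by (intro lattice_mono) auto
    then show ?thesis using lattice_subset_span by blast
  qed
  moreover have "ht n s m \<odot> (basis_elt n s * X m) \<in> low (\<lambda>j. ht n s j + ht 1 m j)"
    by (rule good_low[OF good]) auto
  ultimately have "ht n s m \<odot> (basis_elt n s * X m) \<in> L.span (range triangular_elt)"
    by blast
  from scale_in_span[OF this, of "- ht n s m"] have "x * X m \<in> L.span (range triangular_elt)"
    by (simp add: a triangular_elt_def n_def s_def)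
  with step(2) show ?case
    by (simp add: distrib_right lscale_mult L.span_add L.span_scale)
qed

text \<open>The span is thus a right module over the cluster algebra. As it contains 1, it contains
  the algebra, and no product of two general basis elements has to be expanded.\<close>

lemma span_mult_A:
  assumes "y \<in> A" "x \<in> L.span (range triangular_elt)"
  shows "x * y \<in> L.span (range triangular_elt)"
  using assms unfolding cluster_algebra_def
proof (induction arbitrary: x)
  case (gen y)
  then show ?case using span_mult_X by auto
next
  case (scalar p)
  have "x * eval_laurent v p = lscale v p x"
    using mult_lscale[of x p 1] by (simp add: lscale_def)
  with scalar show ?case by (simp add: L.span_scale)
qed (simp_all add: distrib_left L.span_add flip: mult.assoc)

lemma triangular_elt_0: "triangular_elt (0, 0) = 1"
  by (simp add: triangular_elt_def label_def basis_elt_0)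

lemma A_eq_span: "A = L.span (range triangular_elt)"
proof
  show "A \<subseteq> L.span (range triangular_elt)"
  proof
    fix y assume "y \<in> A"
    moreover have "1 \<in> L.span (range triangular_elt)"
      by (metis L.span_base rangeI triangular_elt_0)
    ultimately show "y \<in> L.span (range triangular_elt)"
      using span_mult_A by force
  qed
  show "L.span (range triangular_elt) \<subseteq> A"
    using A_triangular_elt by (intro L.span_minimal L.subspaceI) (auto intro: A_0 A_add A_lscale)
qed

lemma A_torus: "A \<subseteq> torus"
  unfolding A_eq_span using triangular_elt_torus by (intro L.span_minimal) auto

lemma tbar_A:
  assumes "x \<in> A"
  shows "tbar x \<in> A"
proof -
  have "x \<in> torus \<and> tbar x \<in> A"
    using assms[unfolded A_eq_span]
  proof (induction rule: L.span_induct_alt)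
    case base
    then show ?case by (simp add: L.span_zero A_0)
  next
    case (step c x y)
    then obtain a where "x = triangular_elt a" by blast
    with step(2) show ?case
      by (simp add: tbar_add tbar_lscale tbar_triangular_elt triangular_elt_torus L.span_scale L.span_add
          A_add A_lscale A_triangular_elt)
  qed
  then show ?thesis ..
qed

lemma tbar_v: "tbar v = inverse v"
proof -
  have "tbar (1 \<odot> 1) = (- 1) \<odot> tbar 1"
    using tmon_torus[of "(0, 0)"] by (intro tbar_scale) (simp add: tmon_0)
  then show ?thesis by (simp add: tbar_1 scale_def)
qed

section \<open>Uniqueness of the bar involution\<close>

lemma bar_involution_cong:
  assumes "is_bar_involution v X \<beta>" "\<And>x. x \<in> A \<Longrightarrow> \<beta>' x = \<beta> x"
  shows "is_bar_involution v X \<beta>'"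
proof -
  have "v \<in> A" using A_power_int[of 1] by simp
  with assms show ?thesis
    unfolding is_bar_involution_def by (auto simp: A_X A_add A_mult)
qed

lemma is_bar_involution_tbar: "is_bar_involution v X tbar"
  unfolding is_bar_involution_def
  using A_torus by (auto simp: tbar_A tbar_tbar tbar_add tbar_mult tbar_v tbar_X subset_eq)

lemma bar_involution_power_int:
  assumes "is_bar_involution v X \<beta>"
  shows "\<beta> (v powi k) = v powi (- k)"
proof -
  have mult: "\<beta> (x * y) = \<beta> y * \<beta> x" if "x \<in> A" "y \<in> A" for x y
    using assms that by (auto simp: is_bar_involution_def)
  have v: "\<beta> v = inverse v" and X: "\<beta> (X 1) = X 1"
    using assms by (auto simp: is_bar_involution_def)
  \<comment> \<open>That 1 is fixed is not part of \<open>is_bar_involution\<close>; it follows by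
    cancelling the fixed nonzero element X 1.\<close>
  have "\<beta> 1 * X 1 = \<beta> (X 1 * 1)"
    using mult[OF A_X A_1, of 1] X by simp
  then have one: "\<beta> 1 = 1"
    using X X_nonzero[of 1] by simp
  have v_A: "v \<in> A" and iv_A: "inverse v \<in> A"
    using A_power_int[of 1] A_power_int[of "-1"] by (simp_all add: power_int_minus)
  have "\<beta> (inverse v) * inverse v = 1"
    using mult[OF v_A iv_A] one by (simp add: v)
  then have iv: "\<beta> (inverse v) = v"
    by (metis inverse_unique inverse_inverse_eq nonzero_imp_inverse_nonzero v_nonzero mult.assoc left_inverse mult_1_right mult_1_left)
  have pow: "\<beta> (x ^ n) = \<beta> x ^ n" if "x \<in> A" for x n
    by (induction n) (simp_all add: one mult A_power that power_commutes)
  show ?thesis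
    by (cases "k \<ge> 0") (auto simp: power_int_def pow v_A iv_A v iv)
qed

lemma bar_involution_unique:
  assumes \<beta>: "is_bar_involution v X \<beta>" and \<gamma>: "is_bar_involution v X \<gamma>" and "x \<in> A"
  shows "\<beta> x = \<gamma> x"
proof -
  have add: "\<beta> (x + y) = \<beta> x + \<beta> y" "\<gamma> (x + y) = \<gamma> x + \<gamma> y" if "x \<in> A" "y \<in> A" for x y
    using \<beta> \<gamma> that by (auto simp: is_bar_involution_def)
  have mult: "\<beta> (x * y) = \<beta> y * \<beta> x" "\<gamma> (x * y) = \<gamma> y * \<gamma> x" if "x \<in> A" "y \<in> A" for x y
    using \<beta> \<gamma> that by (auto simp: is_bar_involution_def)
  have zero: "\<beta> 0 = 0" "\<gamma> 0 = 0"
    using add[OF A_0 A_0] by simp_all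
  have diff: "\<beta> (x - y) = \<beta> x - \<beta> y" "\<gamma> (x - y) = \<gamma> x - \<gamma> y" if "x \<in> A" "y \<in> A" for x y
    using add[OF A_diff[OF that] that(2)] by simp_all
  have scalar: "\<beta> (eval_laurent v p) = \<gamma> (eval_laurent v p)" for p
    using subset_UNIV[of "Poly_Mapping.keys p"]
  proof (induction p rule: frag_induction)
    case (one k)
    then show ?case
      using bar_involution_power_int[OF \<beta>, of k] bar_involution_power_int[OF \<gamma>, of k]
      by (simp add: eval_laurent_single)
  qed (simp_all add: zero eval_laurent_diff diff A_scalar)
  have "x \<in> A \<and> \<beta> x = \<gamma> x"
    using \<open>x \<in> A\<close> unfolding cluster_algebra_def
  proof (induction rule: laurent_subalgebra.induct)
    case (gen x)
    then show ?case
      using \<beta> \<gamma> laurent_subalgebra.gen[of x "range X" v] by (auto simp: is_bar_involution_def)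
  qed (auto simp: scalar add mult simp flip: cluster_algebra_def intro: A_scalar A_add A_mult)
  then show ?thesis ..
qed

lemma bar_eq:
  assumes "x \<in> A"
  shows "bar v X x = tbar x"
proof -
  have "bar v X = restrict tbar A"
    unfolding bar_def
  proof (rule the_equality)
    show "is_bar_involution v X (restrict tbar A) \<and> restrict tbar A \<in> extensional A"
      using bar_involution_cong[OF is_bar_involution_tbar, of "restrict tbar A"] by simp
    fix \<beta> assume \<beta>: "is_bar_involution v X \<beta> \<and> \<beta> \<in> extensional A"
    then show "\<beta> = restrict tbar A"
      using bar_involution_unique[of \<beta> tbar] is_bar_involution_tbar
      by (intro extensionalityI[of _ A]) auto
  qed
  with assms show ?thesis by simp
qed

section \<open>Uniqueness of the canonical triangular basis\<close>

lemma single_mult_v_Zv: "p \<in> nonneg_laurent \<Longrightarrow> Poly_Mapping.single 1 1 * p \<in> v_Zv"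
  using Poly_Mapping.keys_mult[of "Poly_Mapping.single (1::int) (1::int)" p]
  by (fastforce simp: v_Zv_def nonneg_laurent_def)

lemma v_Zv_single_mult:
  assumes "p \<in> v_Zv"
  obtains q where "q \<in> nonneg_laurent" "p = Poly_Mapping.single 1 1 * q"
proof
  show "Poly_Mapping.single (-1) 1 * p \<in> nonneg_laurent"
    using assms Poly_Mapping.keys_mult[of "Poly_Mapping.single (-1::int) (1::int)" p]
    by (fastforce simp: v_Zv_def nonneg_laurent_def)
  show "p = Poly_Mapping.single 1 1 * (Poly_Mapping.single (-1) 1 * p)"
    by (simp add: mult_single flip: mult.assoc)
qed

lemma scale_lattice_v_Zv:
  fixes b :: "'i \<Rightarrow> 'a"
  shows "(\<lambda>y. 1 \<odot> y) ` lattice (range b) =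
           {\<Sum>i\<in>I. lscale v (p i) (b i) | I p. finite I \<and> (\<forall>i\<in>I. p i \<in> v_Zv)}" (is "?L = ?R")
proof (intro equalityI subsetI)
  fix x assume "x \<in> ?L"
  then obtain I p where x: "x = 1 \<odot> (\<Sum>i\<in>I. lscale v (p i) (b i))" and I: "finite I" "\<forall>i\<in>I. p i \<in> nonneg_laurent"
    unfolding lattice_range by blast
  have "x = (\<Sum>i\<in>I. lscale v (Poly_Mapping.single 1 1 * p i) (b i))"
    unfolding x lscale_single[symmetric] L.scale_sum_right by simp
  moreover have "\<forall>i\<in>I. Poly_Mapping.single 1 1 * p i \<in> v_Zv"
    using I single_mult_v_Zv by blast
  ultimately show "x \<in> ?R"
    using I(1) by (intro CollectI exI[of _ I] exI[of _ "\<lambda>i. Poly_Mapping.single 1 1 * p i"]) simp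
next
  fix x assume "x \<in> ?R"
  then obtain I p where x: "x = (\<Sum>i\<in>I. lscale v (p i) (b i))" and I: "finite I" "\<forall>i\<in>I. p i \<in> v_Zv"
    by blast
  from I(2) have "\<forall>i\<in>I. \<exists>q. q \<in> nonneg_laurent \<and> p i = Poly_Mapping.single 1 1 * q"
    by (meson v_Zv_single_mult)
  then obtain q where q: "\<And>i. i \<in> I \<Longrightarrow> q i \<in> nonneg_laurent" "\<And>i. i \<in> I \<Longrightarrow> p i = Poly_Mapping.single 1 1 * q i"
    by metis
  have "x = 1 \<odot> (\<Sum>i\<in>I. lscale v (q i) (b i))"
    unfolding x lscale_single[symmetric] L.scale_sum_right by (intro sum.cong) (auto simp: q(2))
  moreover have "(\<Sum>i\<in>I. lscale v (q i) (b i)) \<in> lattice (range b)"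
    using q(1) I(1) unfolding lattice_range by blast
  ultimately show "x \<in> ?L" by blast
qed

lemma v_lattice_eq: "v_lattice v X = (\<lambda>y. 1 \<odot> y) ` lattice (range E)"
  unfolding scale_lattice_v_Zv v_lattice_def by blast

text \<open>Re-expand in the elements \<open>triangular_elt\<close>, which \<open>tbar\<close>
  fixes: the coefficients remain in v Z[v], and independence makes each of them invariant under
  \<open>laurent_bar\<close>, hence zero.\<close>

lemma tbar_fixed_v_lattice:
  assumes "x \<in> v_lattice v X" "tbar x = x"
  shows "x = 0"
proof -
  have "lattice (range E) \<subseteq> lattice (range triangular_elt)"
    by (rule lattice_subset) (auto intro: E_lattice)
  then have "x \<in> (\<lambda>y. 1 \<odot> y) ` lattice (range triangular_elt)"
    using assms(1) unfolding v_lattice_eq by blast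
  then obtain I p where x: "x = (\<Sum>i\<in>I. lscale v (p i) (triangular_elt i))" and I: "finite I" "\<forall>i\<in>I. p i \<in> v_Zv"
    unfolding scale_lattice_v_Zv by blast
  have "tbar (\<Sum>i\<in>I. lscale v (p i) (triangular_elt i)) = (\<Sum>i\<in>I. lscale v (laurent_bar (p i)) (triangular_elt i))"
    using I(1)
    by induction (simp_all add: tbar_add tbar_lscale tbar_triangular_elt triangular_elt_torus L.span_scale L.span_sum)
  with assms(2) have "(\<Sum>i\<in>I. lscale v (laurent_bar (p i) - p i) (triangular_elt i)) = 0"
    by (simp add: x L.scale_left_diff_distrib sum_subtractf)
  then have "laurent_bar (p i) - p i = 0" if "i \<in> I" for i
    using that
    by (rule independent_familyD[OF triangular_elt_independent I(1), where p = "\<lambda>i. laurent_bar (p i) - p i"])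
  then have "p i = 0" if "i \<in> I" for i
    using I(2) that laurent_bar_fixed_v_Zv by simp
  then show ?thesis by (simp add: x)
qed

lemma is_canonical_triangular_elt: "is_canonical_triangular_basis v X triangular_elt"
  unfolding is_canonical_triangular_basis_def laurent_basis_def
proof (intro conjI allI)
  show "inj triangular_elt" "\<not> L.dependent (range triangular_elt)"
    by (rule independent_family_inj independent_family_independent, rule triangular_elt_independent)+
  show "L.span (range triangular_elt) = A"
    by (simp add: A_eq_span)
  fix a
  show "bar v X (triangular_elt a) = triangular_elt a"
    by (simp add: bar_eq A_triangular_elt tbar_triangular_elt)
  obtain y where "y \<in> lattice (range E)" "triangular_elt a = E a + 1 \<odot> y"
    using triangular_elt_expansion by blast
  then show "triangular_elt a - E a \<in> v_lattice v X"
    unfolding v_lattice_eq by simp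
qed

lemma canonical_triangular_basis_eq: "canonical_triangular_basis v X = triangular_elt"
  unfolding canonical_triangular_basis_def
proof (rule the_equality)
  show "is_canonical_triangular_basis v X triangular_elt"
    by (rule is_canonical_triangular_elt)
  fix C assume C: "is_canonical_triangular_basis v X C"
  show "C = triangular_elt"
  proof
    fix a
    have "L.span (range C) = A"
      using C by (simp add: is_canonical_triangular_basis_def laurent_basis_def)
    then have C_A: "C a \<in> A"
      using L.span_base[of "C a" "range C"] by blast
    have "C a - E a \<in> v_lattice v X" "triangular_elt a - E a \<in> v_lattice v X"
      using C is_canonical_triangular_elt unfolding is_canonical_triangular_basis_def by blast+
    then obtain y w where y: "C a - E a = 1 \<odot> y" "y \<in> lattice (range E)"
      and w: "triangular_elt a - E a = 1 \<odot> w" "w \<in> lattice (range E)"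
      unfolding v_lattice_eq by blast
    have "C a - triangular_elt a = 1 \<odot> (y - w)"
      unfolding scale_diff y(1)[symmetric] w(1)[symmetric] by simp
    then have "C a - triangular_elt a \<in> v_lattice v X"
      unfolding v_lattice_eq using y(2) w(2) lattice_diff by blast
    moreover have "bar v X (C a) = C a"
      using C unfolding is_canonical_triangular_basis_def by blast
    then have "tbar (C a) = C a"
      using bar_eq[OF C_A] by simp
    then have "tbar (C a - triangular_elt a) = C a - triangular_elt a"
      using C_A A_torus by (simp add: tbar_diff triangular_elt_torus tbar_triangular_elt subset_eq)
    ultimately have "C a - triangular_elt a = 0"
      by (rule tbar_fixed_v_lattice)
    then show "C a = triangular_elt a" by simp
  qed
qed

lemma range_triangular_elt:
  "range triangular_elt =
     {cluster_monomial v X m p q | m p q. True} \<union> {chebyshev_S r (X_delta v X) | r. r \<ge> 1}"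
proof (intro equalityI subsetI)
  fix x assume "x \<in> range triangular_elt"
  then obtain a where a: "x = triangular_elt a" by blast
  show "x \<in> {cluster_monomial v X m p q | m p q. True} \<union> {chebyshev_S r (X_delta v X) | r. r \<ge> 1}"
  proof (cases "fst (label a) = 0")
    case True
    then obtain r where r: "x = S r"
      by (auto simp: a triangular_elt_def basis_elt_0)
    show ?thesis
    proof (cases "r = 0")
      case True
      \<comment> \<open>S 0 = 1 is the empty cluster monomial, which is why the Chebyshev elements
        are listed from r = 1 on.\<close>
      then have "x = cluster_monomial v X 0 0 0" by (simp add: r cluster_monomial_def)
      then show ?thesis by blast
    next
      case False
      then show ?thesis using r by (auto intro!: exI[of _ r])
    qed
  next
    case False
    then show ?thesis
      unfolding a triangular_elt_def basis_elt_def by auto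
  qed
next
  fix x assume "x \<in> {cluster_monomial v X m p q | m p q. True} \<union> {chebyshev_S r (X_delta v X) | r. r \<ge> 1}"
  then consider m p q where "x = cluster_monomial v X m p q" | r where "x = S r"
    by blast
  then obtain n s where "x = basis_elt n s"
  proof cases
    case (1 m p q)
    show thesis by (rule that[OF trans[OF 1 basis_elt_monomial[symmetric]]])
  next
    case (2 r)
    then show thesis using that[of 0 "int r"] by (simp add: basis_elt_0)
  qed
  then show "x \<in> range triangular_elt"
    by (simp add: basis_elt_eq_triangular_elt)
qed

end

theorem proposition6p1:
  fixes v :: "'a::division_ring" and X :: "int \<Rightarrow> 'a"
  assumes "cluster_variables_A11 v X"
  shows "range (canonical_triangular_basis v X) =
           {cluster_monomial v X m a1 a2 | (m::int) (a1::nat) (a2::nat). True} \<union>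
           {chebyshev_S r (X_delta v X) | r::nat. r \<ge> 1}"
proof -
  interpret quantum_cluster_A11 v X
    by unfold_locales (rule assms)
  show ?thesis
    unfolding canonical_triangular_basis_eq by (rule range_triangular_elt)
qed

end
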